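(* Let $\mathcal R$ be a unique factorisation domain (e.g. $\mathbb Z$, or a polynomial ring over $\mathbb Z$), and let $d,k\ge 1$. Consider a system of $d$ recurrences of order $k$, $$\tau_n^i=\frac{P^i(\tau^1_{n-k},\dots,\tau^d_{n-k},\dots,\tau^1_{n-1},\dots,\tau^d_{n-1})}{Q^i(\tau^1_{n-k},\dots,\tau^d_{n-1})},\qquad i=1,\dots,d,$$ where each $P^i$ is a polynomial and each $Q^i$ is a monomial over $\mathcal R$ in the $kd$ variables $\tau^j_{n-l}$ ($1\le j\le d$, $1\le l\le k$). Take the set of initial values $U=\{\tau^j_l:1\le j\le d,\ 0\le l\le k-1\}$ as independent indeterminates and write each iterate as $\tau_n^i=p_n^i/q_n^i$ with $p_n^i,q_n^i\in\mathcal R[U]$ coprime. Let $I\subset\{1,\dots,d\}$ and $V=\{\tau^j_l: j\in I,\ 0\le l\le k-1\}\subset U$, $W=U\setminus V$. Suppose that $q_k^i$ is a monomial in $\mathcal R[V]$ for $1\le i\le d$; that $p_k^i$ is coprime to $p_{k+l}^j$ for all $i,j\in I$ and $l=1,\dots,k$; and that $q_m^i$ is a monomial in $\mathcal R[V]$ for $1\le i\le d$ and $k+1\le m\le 2k$. Then the system has the Laurent property: for all $i$ and all $n\ge 0$, $\tau_n^i$ is a Laurent polynomial in the variables of $V$ and polynomial in the variables of $W$, i.e. $\tau_n^i\in\mathcal R[W][V^{\pm1}]$.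
   Context: Superscripts denote components, not exponents. A monomial here means a product of a unit/coefficient of $\mathcal R$ with powers of the variables. Coprimality of polynomials means having no common non-unit factor. *)

theory Defs
  imports "HOL-Library.Poly_Mapping" "HOL-Library.Product_Lexorder" "HOL-Computational_Algebra.Factorial_Ring"
    "HOL-Computational_Algebra.Fraction_Field"
begin

text \<open>Multivariate polynomials over a coefficient ring 'a in the variables
  (j, l) :: nat \<times> nat; the variable (j, l) stands for tau^j_l (for the initial
  values) or for tau^j_{n-l} (as argument of the recurrence polynomials).\<close>
type_synonym 'a mpoly = "((nat \<times> nat) \<Rightarrow>\<^sub>0 nat) \<Rightarrow>\<^sub>0 'a"

definition vars :: "'a::zero mpoly \<Rightarrow> (nat \<times> nat) set" where
  "vars p = (\<Union>m\<in>Poly_Mapping.keys p. Poly_Mapping.keys m)"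

definition in_ring :: "(nat \<times> nat) set \<Rightarrow> 'a::zero mpoly \<Rightarrow> bool" where
  "in_ring X p \<longleftrightarrow> vars p \<subseteq> X"

definition mvar :: "nat \<times> nat \<Rightarrow> 'a::comm_semiring_1 mpoly" where
  "mvar v = Poly_Mapping.single (Poly_Mapping.single v 1) 1"

definition is_monomial_in :: "(nat \<times> nat) set \<Rightarrow> 'a::comm_semiring_1 mpoly \<Rightarrow> bool" where
  "is_monomial_in X p \<longleftrightarrow>
     (\<exists>c m. c dvd 1 \<and> Poly_Mapping.keys m \<subseteq> X \<and> p = Poly_Mapping.single m c)"

definition dvd_in :: "(nat \<times> nat) set \<Rightarrow> 'a::comm_semiring_1 mpoly \<Rightarrow> 'a mpoly \<Rightarrow> bool" where
  "dvd_in X a b \<longleftrightarrow> (\<exists>e. in_ring X e \<and> b = a * e)"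

definition coprime_in :: "(nat \<times> nat) set \<Rightarrow> 'a::comm_semiring_1 mpoly \<Rightarrow> 'a mpoly \<Rightarrow> bool" where
  "coprime_in X a b \<longleftrightarrow>
     (\<forall>c. in_ring X c \<longrightarrow> dvd_in X c a \<longrightarrow> dvd_in X c b \<longrightarrow> dvd_in X c 1)"

abbreviation to_frac :: "'a::idom mpoly \<Rightarrow> 'a mpoly fract" where
  "to_frac p \<equiv> Fract p 1"

definition meval :: "(nat \<times> nat \<Rightarrow> 'a::idom mpoly fract) \<Rightarrow> 'a mpoly \<Rightarrow> 'a mpoly fract" where
  "meval f p = (\<Sum>m\<in>Poly_Mapping.keys p. to_frac (Poly_Mapping.single 0 (Poly_Mapping.lookup p m)) *
                    (\<Prod>v\<in>Poly_Mapping.keys m. f v ^ Poly_Mapping.lookup m v))"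

end

theory Submission
  imports "HOL-Computational_Algebra.Polynomial" Defs
begin

text \<open>The recurrence is autonomous, so \<open>\<tau>\<^sub>n\<close> is obtained from \<open>\<tau>\<^bsub>n-s\<^esub>\<close> by substituting
  \<open>\<tau>\<^sub>s, \<dots>, \<tau>\<^bsub>s+k-1\<^esub>\<close> for the initial values. If \<open>\<tau>\<^bsub>n-1\<^esub>\<close> and \<open>\<tau>\<^bsub>n-k-1\<^esub>\<close> are Laurent, then
  \<open>s = 1\<close> shows that \<open>\<tau>\<^sub>n\<close> becomes Laurent after multiplication by a product of numerators
  \<open>p\<^sub>k\<close>, and \<open>s = k + 1\<close> that it becomes Laurent after multiplication by a product of
  numerators \<open>p\<^bsub>k+l\<^esub>\<close>, \<open>1 \<le> l \<le> k\<close>. These products are coprime, and polynomial rings over a UFD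
  are UFDs, so \<open>\<tau>\<^sub>n\<close> itself is Laurent.

  A numerator may vanish; coprimality then forces all numerators of the other product to be
  units, and a single shift suffices.\<close>

section \<open>Evaluation homomorphisms\<close>

definition mono_eval :: "('v \<Rightarrow> 'b::comm_semiring_1) \<Rightarrow> ('v \<Rightarrow>\<^sub>0 nat) \<Rightarrow> 'b" where
  "mono_eval g m = (\<Prod>v\<in>Poly_Mapping.keys m. g v ^ Poly_Mapping.lookup m v)"

lemma mono_eval_superset:
  assumes "finite S" "Poly_Mapping.keys m \<subseteq> S"
  shows "mono_eval g m = (\<Prod>v\<in>S. g v ^ Poly_Mapping.lookup m v)"
  unfolding mono_eval_def using assms
  by (intro prod.mono_neutral_left) (auto simp: in_keys_iff)

lemma mono_eval_zero [simp]: "mono_eval g 0 = 1"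
  by (simp add: mono_eval_def)

lemma mono_eval_single [simp]: "mono_eval g (Poly_Mapping.single v n) = g v ^ n"
  by (simp add: mono_eval_def)

lemma mono_eval_add: "mono_eval g (m + m') = mono_eval g m * mono_eval g m'"
proof -
  let ?S = "Poly_Mapping.keys m \<union> Poly_Mapping.keys m'"
  have "Poly_Mapping.keys (m + m') \<subseteq> ?S" by (rule keys_add)
  then show ?thesis
    by (simp add: mono_eval_superset[of ?S] lookup_add power_add prod.distrib)
qed

text \<open>The coefficient map is a parameter because three evaluations are needed: substitution in
  the fraction field, passage to univariate polynomials, and the identity, which arises by
  substituting each variable for itself.\<close>

definition mpoly_eval ::
    "('a::comm_semiring_1 \<Rightarrow> 'b::comm_semiring_1) \<Rightarrow> ('v \<Rightarrow> 'b) \<Rightarrow> (('v \<Rightarrow>\<^sub>0 nat) \<Rightarrow>\<^sub>0 'a) \<Rightarrow> 'b" where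
  "mpoly_eval c g p = (\<Sum>m\<in>Poly_Mapping.keys p. c (Poly_Mapping.lookup p m) * mono_eval g m)"

lemma mpoly_eval_single:
  "c 0 = 0 \<Longrightarrow> mpoly_eval c g (Poly_Mapping.single m a) = c a * mono_eval g m"
  by (simp add: mpoly_eval_def)

lemma mpoly_eval_zero [simp]: "mpoly_eval c g 0 = 0"
  by (simp add: mpoly_eval_def)

lemma sum_single_lookup:
  fixes p :: "'v \<Rightarrow>\<^sub>0 'a::comm_monoid_add"
  shows "(\<Sum>m\<in>Poly_Mapping.keys p. Poly_Mapping.single m (Poly_Mapping.lookup p m)) = p"
proof (rule poly_mapping_eqI)
  fix k
  show "Poly_Mapping.lookup (\<Sum>m\<in>Poly_Mapping.keys p. Poly_Mapping.single m (Poly_Mapping.lookup p m)) k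
      = Poly_Mapping.lookup p k"
    by (auto simp: lookup_sum lookup_single when_def sum.delta in_keys_iff)
qed

text \<open>The index type is arbitrary, so the rule serves for polynomials and for exponent vectors
  alike; both are finitely supported maps.\<close>

lemma mpoly_induct [case_names zero single add]:
  fixes p :: "'v \<Rightarrow>\<^sub>0 'a::comm_monoid_add"
  assumes "P 0" "\<And>m c. P (Poly_Mapping.single m c)" "\<And>p q. P p \<Longrightarrow> P q \<Longrightarrow> P (p + q)"
  shows "P p"
proof -
  have "P (\<Sum>m\<in>S. Poly_Mapping.single m (Poly_Mapping.lookup p m))" if "finite S" for S
    using that by (induction S) (auto intro: assms)
  then show ?thesis using sum_single_lookup[of p] by (metis finite_keys)
qed

lemma keys_add_nat: "Poly_Mapping.keys (m + m') = Poly_Mapping.keys m \<union> Poly_Mapping.keys (m' :: 'v \<Rightarrow>\<^sub>0 nat)"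
  by (auto simp: in_keys_iff lookup_add)

locale coefficient_hom =
  fixes c :: "'a::comm_semiring_1 \<Rightarrow> 'b::comm_semiring_1"
  assumes hom_zero [simp]: "c 0 = 0" and hom_one [simp]: "c 1 = 1"
    and hom_add: "c (x + y) = c x + c y" and hom_mult: "c (x * y) = c x * c y"
begin

lemma eval_add: "mpoly_eval c g (p + q) = mpoly_eval c g p + mpoly_eval c g q"
proof -
  let ?S = "Poly_Mapping.keys p \<union> Poly_Mapping.keys q"
  have *: "mpoly_eval c g r = (\<Sum>m\<in>?S. c (Poly_Mapping.lookup r m) * mono_eval g m)"
    if "Poly_Mapping.keys r \<subseteq> ?S" for r
    unfolding mpoly_eval_def using that
    by (intro sum.mono_neutral_left) (auto simp: in_keys_iff)
  have "Poly_Mapping.keys (p + q) \<subseteq> ?S" by (rule keys_add)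
  then show ?thesis
    by (simp add: * lookup_add hom_add ring_distribs sum.distrib distrib_right)
qed

lemma eval_single: "mpoly_eval c g (Poly_Mapping.single m a) = c a * mono_eval g m"
  by (simp add: mpoly_eval_single)

lemma eval_one [simp]: "mpoly_eval c g 1 = 1"
  using eval_single[of g 0 1] by simp

lemma eval_mult: "mpoly_eval c g (p * q) = mpoly_eval c g p * mpoly_eval c g q"
proof (induction p rule: mpoly_induct)
  case (single m a)
  show ?case
  proof (induction q rule: mpoly_induct)
    case (single m' b)
    show ?case
      by (simp add: mult_single eval_single mono_eval_add hom_mult ac_simps)
  qed (simp_all add: eval_add distrib_left)
qed (simp_all add: eval_add distrib_right)

lemma eval_var: "mpoly_eval c g (Poly_Mapping.single (Poly_Mapping.single v 1) 1) = g v"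
  by (simp add: eval_single)

end

text \<open>Transfer principle: a relation respected by 1 and by products survives substitution into
  a monomial. If \<open>R\<close> ignores its second argument, this is closure of a set; if
  \<open>R\<close> is the graph of a homomorphism, it is naturality.\<close>

lemma rel_mono_eval:
  assumes "R 1 1" and "\<And>x y x' y'. R x x' \<Longrightarrow> R y y' \<Longrightarrow> R (x * y) (x' * y')"
    and "\<And>v. v \<in> Poly_Mapping.keys m \<Longrightarrow> R (g v) (g' v)"
  shows "R (mono_eval g m) (mono_eval g' m)"
proof -
  have pow: "R (x ^ n) (x' ^ n)" if "R x x'" for x x' n
    using that by (induction n) (auto intro: assms(1,2))
  have "R (\<Prod>v\<in>S. g v ^ Poly_Mapping.lookup m v) (\<Prod>v\<in>S. g' v ^ Poly_Mapping.lookup m v)"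
    if "finite S" "S \<subseteq> Poly_Mapping.keys m" for S
    using that by (induction S) (auto intro: assms pow)
  then show ?thesis by (simp add: mono_eval_def)
qed

text \<open>The same principle with sums. Later instances are closure of subrings under evaluation,
  comparison of two evaluations, and compatibility of evaluation with the index shift.\<close>

lemma rel_mpoly_eval:
  assumes "R 0 0" "R 1 1"
    and "\<And>x y x' y'. R x x' \<Longrightarrow> R y y' \<Longrightarrow> R (x + y) (x' + y')"
    and "\<And>x y x' y'. R x x' \<Longrightarrow> R y y' \<Longrightarrow> R (x * y) (x' * y')"
    and "\<And>a. R (c a) (c' a)"
    and "\<And>v m. m \<in> Poly_Mapping.keys p \<Longrightarrow> v \<in> Poly_Mapping.keys m \<Longrightarrow> R (g v) (g' v)"
  shows "R (mpoly_eval c g p) (mpoly_eval c' g' p)"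
proof -
  have "R (\<Sum>m\<in>S. c (Poly_Mapping.lookup p m) * mono_eval g m)
          (\<Sum>m\<in>S. c' (Poly_Mapping.lookup p m) * mono_eval g' m)"
    if "finite S" "S \<subseteq> Poly_Mapping.keys p" for S
    using that
  proof (induction S)
    case (insert m S)
    have "R (mono_eval g m) (mono_eval g' m)"
      by (rule rel_mono_eval) (use insert assms in auto)
    with insert show ?case by (simp add: assms)
  qed (simp add: assms)
  then show ?thesis by (simp add: mpoly_eval_def)
qed

lemma mono_eval_mvar: "mono_eval mvar m = Poly_Mapping.single m (1::'a::comm_semiring_1)"
proof (induction m rule: mpoly_induct)
  case (single v n)
  show ?case
  proof (induction n)
    case (Suc n)
    have "Poly_Mapping.single v (Suc n) = Poly_Mapping.single v n + Poly_Mapping.single v 1"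
      by (simp flip: single_add)
    then show ?case using Suc
      by (simp add: mono_eval_add mvar_def mult_single)
  qed simp
qed (simp_all add: mono_eval_add mult_single)

text \<open>Lets \<open>poly_uni_var\<close> and \<open>uni_var_const\<close> recover
  \<open>p\<close> from its univariate form: both reduce to replacing every variable by
  itself.\<close>

lemma mpoly_eval_mvar: "mpoly_eval (Poly_Mapping.single 0) mvar p = p"
proof -
  have "mpoly_eval (Poly_Mapping.single 0) mvar p
     = (\<Sum>m\<in>Poly_Mapping.keys p. Poly_Mapping.single m (Poly_Mapping.lookup p m))"
    unfolding mpoly_eval_def
    by (intro sum.cong) (auto simp: mono_eval_mvar mult_single)
  then show ?thesis by (simp add: sum_single_lookup)
qed

section \<open>The subrings \<open>R[X]\<close>\<close>

lemma in_ring_iff: "in_ring X p \<longleftrightarrow> (\<forall>m\<in>Poly_Mapping.keys p. Poly_Mapping.keys m \<subseteq> X)"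
  by (auto simp: in_ring_def vars_def)

lemma in_ring_0 [simp]: "in_ring X 0" and in_ring_1 [simp]: "in_ring X 1"
  by (auto simp: in_ring_iff)

lemma in_ring_add: "in_ring X p \<Longrightarrow> in_ring X q \<Longrightarrow> in_ring X (p + q)"
  using keys_add[of p q] by (auto simp: in_ring_iff)

lemma in_ring_uminus: "in_ring X (p :: 'a::ab_group_add mpoly) \<Longrightarrow> in_ring X (- p)"
  by (auto simp: in_ring_iff in_keys_iff)

lemma in_ring_diff: "in_ring X (p :: 'a::ab_group_add mpoly) \<Longrightarrow> in_ring X q \<Longrightarrow> in_ring X (p - q)"
  using in_ring_add[of X p "- q"] in_ring_uminus[of X q] by simp

lemma in_ring_mult: "in_ring X p \<Longrightarrow> in_ring X q \<Longrightarrow> in_ring X (p * q)"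
  using keys_mult[of p q] by (fastforce simp: in_ring_iff keys_add_nat)

lemma in_ring_single: "Poly_Mapping.keys m \<subseteq> X \<Longrightarrow> in_ring X (Poly_Mapping.single m c)"
  by (simp add: in_ring_iff)

lemma in_ring_mvar: "v \<in> X \<Longrightarrow> in_ring X (mvar v)"
  by (simp add: mvar_def in_ring_single)

lemma in_ring_prod: "(\<And>i. i \<in> S \<Longrightarrow> in_ring X (f i)) \<Longrightarrow> in_ring X (\<Prod>i\<in>S. f i)"
  by (induction S rule: infinite_finite_induct) (auto simp: in_ring_mult)

lemma in_ring_power: "in_ring X p \<Longrightarrow> in_ring X (p ^ n)"
  by (induction n) (auto simp: in_ring_mult)

section \<open>Multivariate polynomials as univariate polynomials in one chosen variable\<close>

text \<open>The coefficients keep the full type \<open>'a mpoly\<close>; that they avoid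
  \<open>v\<close> is recorded separately, through \<open>in_ring\<close>.\<close>

definition uni_var :: "nat \<times> nat \<Rightarrow> 'a::comm_ring_1 mpoly \<Rightarrow> 'a mpoly poly" where
  "uni_var v = mpoly_eval (\<lambda>c. [:Poly_Mapping.single 0 c:]) (\<lambda>w. if w = v then monom 1 1 else [:mvar w:])"

lemma uni_var_coefficient_hom:
  "coefficient_hom (\<lambda>c::'a::comm_ring_1. [:Poly_Mapping.single (0::(nat\<times>nat) \<Rightarrow>\<^sub>0 nat) c:])"
  by unfold_locales (simp_all add: single_add mult_single mult.commute)

lemma uni_var_zero [simp]: "uni_var v 0 = 0"
  by (simp add: uni_var_def)

lemma uni_var_one [simp]: "uni_var v 1 = 1"
  unfolding uni_var_def by (rule coefficient_hom.eval_one[OF uni_var_coefficient_hom])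

lemma uni_var_add: "uni_var v (p + q) = uni_var v p + uni_var v q"
  unfolding uni_var_def by (rule coefficient_hom.eval_add[OF uni_var_coefficient_hom])

lemma uni_var_mult: "uni_var v (p * q) = uni_var v p * uni_var v q"
  unfolding uni_var_def by (rule coefficient_hom.eval_mult[OF uni_var_coefficient_hom])

lemma uni_var_diff: "uni_var v (p - q) = uni_var v p - uni_var v q"
  using uni_var_add[of v "p - q" q] by simp

lemma uni_var_mvar: "uni_var v (mvar v) = monom 1 1"
  unfolding uni_var_def mvar_def by (subst coefficient_hom.eval_var[OF uni_var_coefficient_hom]) simp

text \<open>Evaluation at \<open>mvar v\<close> is a homomorphism, so comparing constants and
  variables suffices. This left inverse makes \<open>uni_var v\<close> injective.\<close>

lemma poly_uni_var: "poly (uni_var v p) (mvar v) = p"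
proof -
  have "poly (uni_var v p) (mvar v) = mpoly_eval (Poly_Mapping.single 0) mvar p"
    unfolding uni_var_def
    by (rule rel_mpoly_eval[where R = "\<lambda>f y. poly f (mvar v) = y"]) (auto simp: poly_monom)
  then show ?thesis by (simp add: mpoly_eval_mvar)
qed

lemma uni_var_eq_0_iff [simp]: "uni_var v p = 0 \<longleftrightarrow> p = 0"
  by (metis poly_0 poly_uni_var uni_var_zero)

lemma uni_var_const:
  assumes "in_ring X p" "v \<notin> X"
  shows "uni_var v p = [:p:]"
proof -
  have "uni_var v p = [:mpoly_eval (Poly_Mapping.single 0) mvar p:]"
    unfolding uni_var_def
    by (rule rel_mpoly_eval[where R = "\<lambda>f y. f = [:y:]"])
       (use assms in \<open>auto simp: in_ring_iff\<close>)
  then show ?thesis by (simp add: mpoly_eval_mvar)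
qed

text \<open>Coefficients of a product are sums of products of coefficients, so having all
  coefficients in \<open>R[X]\<close> is preserved by the ring operations, and it holds for the
  images of \<open>v\<close> and of the variables in \<open>X\<close>.\<close>

lemma coeff_uni_var_in_ring:
  assumes "in_ring (insert v X) p"
  shows "in_ring X (coeff (uni_var v p) i)"
proof -
  have "\<forall>i. in_ring X (coeff (uni_var v p) i)"
    unfolding uni_var_def
  proof (rule rel_mpoly_eval[where R = "\<lambda>f y. \<forall>i. in_ring X (coeff f i)"])
    fix f g :: "'a mpoly poly" assume *: "\<forall>i. in_ring X (coeff f i)" "\<forall>i. in_ring X (coeff g i)"
    have "in_ring X (\<Sum>j\<in>S. coeff f j * coeff g (n - j))" for S :: "nat set" and n
      by (induction S rule: infinite_finite_induct) (use * in \<open>auto intro!: in_ring_add in_ring_mult\<close>)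
    then show "\<forall>i. in_ring X (coeff (f * g) i)" by (simp add: coeff_mult)
  next
    fix w m assume "m \<in> Poly_Mapping.keys p" "w \<in> Poly_Mapping.keys m"
    then have "w = v \<or> w \<in> X" using assms by (auto simp: in_ring_iff)
    then show "\<forall>i. in_ring X (coeff (if w = v then monom 1 1 else [:mvar w:]) i)"
      by (auto simp: in_ring_mvar coeff_pCons split: nat.splits)
  qed (auto simp: in_ring_add in_ring_single coeff_pCons split: nat.splits)
  then show ?thesis by blast
qed

subsection \<open>Degree and leading coefficient in one variable\<close>

definition mdeg :: "nat \<times> nat \<Rightarrow> 'a::comm_ring_1 mpoly \<Rightarrow> nat" where
  "mdeg v p = degree (uni_var v p)"

definition mlead :: "nat \<times> nat \<Rightarrow> 'a::comm_ring_1 mpoly \<Rightarrow> 'a mpoly" where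
  "mlead v p = lead_coeff (uni_var v p)"

lemma mlead_eq_0_iff [simp]: "mlead v p = 0 \<longleftrightarrow> p = 0"
  by (simp add: mlead_def)

lemma mdeg_mult: "p \<noteq> 0 \<Longrightarrow> q \<noteq> 0 \<Longrightarrow> mdeg v (p * q) = mdeg v p + mdeg v (q :: 'a::idom mpoly)"
  by (simp add: mdeg_def uni_var_mult degree_mult_eq)

lemma mdeg_unit:
  fixes a :: "'a::idom mpoly"
  assumes "a dvd 1"
  shows "mdeg v a = 0"
proof -
  obtain b where b: "1 = a * b" using assms by (auto elim: dvdE)
  then have "a \<noteq> 0" "b \<noteq> 0" by auto
  then have "mdeg v a + mdeg v b = mdeg v (1 :: 'a mpoly)"
    using mdeg_mult[of a b v] b by simp
  then show ?thesis by (simp add: mdeg_def)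
qed

lemma mlead_mult: "mlead v (p * q) = mlead v p * mlead v (q :: 'a::idom mpoly)"
  by (simp add: mlead_def uni_var_mult lead_coeff_mult)

lemma mdeg_const: "in_ring X p \<Longrightarrow> v \<notin> X \<Longrightarrow> mdeg v p = 0"
  by (simp add: mdeg_def uni_var_const)

lemma mlead_const: "in_ring X p \<Longrightarrow> v \<notin> X \<Longrightarrow> mlead v p = p"
  by (simp add: mlead_def uni_var_const)

lemma mlead_eq_self: "mdeg v p = 0 \<Longrightarrow> mlead v p = p"
proof -
  assume "mdeg v p = 0"
  then obtain a where a: "uni_var v p = [:a:]" unfolding mdeg_def by (rule degree_eq_zeroE)
  have "a = p" using poly_uni_var[of v p] by (simp add: a)
  with a show "mlead v p = p" by (simp add: mlead_def)
qed

lemma in_ring_mlead: "in_ring (insert v X) p \<Longrightarrow> in_ring X (mlead v p)"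
  by (simp add: mlead_def coeff_uni_var_in_ring)

lemma uni_var_term:
  assumes "in_ring X a" "v \<notin> X"
  shows "uni_var v (a * mvar v ^ n) = monom a n"
proof -
  have "uni_var v (mvar v ^ n) = monom (1 :: 'a mpoly) n"
    by (induction n) (simp_all add: uni_var_mult uni_var_mvar mult_monom monom_0 one_pCons)
  then show ?thesis
    by (simp add: uni_var_mult uni_var_const[OF assms] smult_monom)
qed

lemma mdeg_term: "in_ring X a \<Longrightarrow> v \<notin> X \<Longrightarrow> a \<noteq> 0 \<Longrightarrow> mdeg v (a * mvar v ^ n) = n"
  by (simp add: mdeg_def uni_var_term degree_monom_eq)

lemma mlead_term: "in_ring X a \<Longrightarrow> v \<notin> X \<Longrightarrow> mlead v (a * mvar v ^ n) = a"
  using lead_coeff_monom[of a n] by (simp add: mlead_def uni_var_term del: lead_coeff_monom)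

text \<open>The coefficient at the common degree cancels. The case \<open>p = q\<close> has to be
  excluded since 0 also has degree 0.\<close>

lemma mdeg_diff_less:
  assumes "mdeg v p = mdeg v q" "mlead v p = mlead v q" "p \<noteq> q"
  shows "mdeg v (p - q) < mdeg v p"
proof -
  have "uni_var v (p - q) \<noteq> 0" using assms by simp
  moreover have "coeff (uni_var v (p - q)) (mdeg v p) = 0"
    using assms by (simp add: uni_var_diff mdeg_def mlead_def)
  moreover have "degree (uni_var v (p - q)) \<le> mdeg v p"
    unfolding uni_var_diff using assms(1) by (intro degree_diff_le) (auto simp: mdeg_def)
  ultimately show ?thesis
    unfolding mdeg_def by (metis le_neq_implies_less leading_coeff_0_iff)
qed

text \<open>Over a domain degrees add up, so a factor of a nonzero element of degree 0 in
  \<open>w\<close> has degree 0 in \<open>w\<close>; this is applied to every variable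
  \<open>w\<close> outside \<open>X\<close>.\<close>

lemma in_ring_factor:
  fixes a b :: "'a::idom mpoly"
  assumes "in_ring X (a * b)" "a * b \<noteq> 0"
  shows "in_ring X a"
proof -
  have "w \<notin> vars a" if "w \<notin> X" for w
  proof -
    have "mdeg w (a * b) = 0" using assms that by (simp add: mdeg_const)
    then have "mlead w a = a" using assms mdeg_mult[of a b w] mlead_eq_self[of w a] by auto
    moreover have "in_ring (- {w}) (mlead w a)"
      by (rule in_ring_mlead) (auto simp: in_ring_def)
    ultimately show ?thesis by (auto simp: in_ring_def)
  qed
  then show ?thesis by (auto simp: in_ring_def)
qed

lemma in_ring_dvd: "a dvd b \<Longrightarrow> in_ring X b \<Longrightarrow> b \<noteq> 0 \<Longrightarrow> in_ring X (a :: 'a::idom mpoly)"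
  by (auto elim!: dvdE intro: in_ring_factor)

section \<open>Unique factorisation in \<open>R[X]\<close>\<close>

text \<open>The length function \<open>\<delta>\<close> counts irreducible factors; since the subring is closed
  under factors, divisibility and irreducibility in it agree with those of the ambient domain.\<close>

locale factorial_subring =
  fixes A :: "'b::idom set" and \<delta> :: "'b \<Rightarrow> nat"
  assumes one_in: "1 \<in> A"
    and mult_in: "a \<in> A \<Longrightarrow> b \<in> A \<Longrightarrow> a * b \<in> A"
    and factor_in: "a * b \<in> A \<Longrightarrow> a * b \<noteq> 0 \<Longrightarrow> a \<in> A"
    and length_mult: "a \<in> A \<Longrightarrow> b \<in> A \<Longrightarrow> a \<noteq> 0 \<Longrightarrow> b \<noteq> 0 \<Longrightarrow> \<delta> (a * b) = \<delta> a + \<delta> b"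
    and length_0: "a \<in> A \<Longrightarrow> a \<noteq> 0 \<Longrightarrow> \<delta> a = 0 \<longleftrightarrow> a dvd 1"
    and irreducible_dvd_mult:
      "r \<in> A \<Longrightarrow> irreducible r \<Longrightarrow> a \<in> A \<Longrightarrow> b \<in> A \<Longrightarrow> r dvd a * b \<Longrightarrow> r dvd a \<or> r dvd b"
begin

lemma factors_in:
  assumes "a \<in> A" "a \<noteq> 0" "a = b * c"
  shows "b \<in> A" "c \<in> A" "b \<noteq> 0" "c \<noteq> 0"
  using assms factor_in[of b c] factor_in[of c b] by (simp_all add: mult.commute)

text \<open>A nonunit that is not irreducible splits into two nonunits, and additivity of
  \<open>\<delta>\<close> makes each factor strictly shorter, so the descent ends.\<close>

lemma irreducible_factor_exists:
  assumes "a \<in> A" "a \<noteq> 0" "\<not> a dvd 1"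
  shows "\<exists>r\<in>A. irreducible r \<and> r dvd a"
  using assms
proof (induction "\<delta> a" arbitrary: a rule: less_induct)
  case less
  show ?case
  proof (cases "irreducible a")
    case False
    then obtain b c where bc: "a = b * c" "\<not> b dvd 1" "\<not> c dvd 1"
      using less.prems by (auto simp: irreducible_def)
    have in_A: "b \<in> A" "c \<in> A" "b \<noteq> 0" "c \<noteq> 0"
      using factors_in[OF less.prems(1,2) bc(1)] .
    then have "\<delta> b < \<delta> a" using bc length_mult[of b c] length_0[of c] by auto
    with less.hyps[of b] in_A bc show ?thesis by auto
  qed (use less.prems in auto)
qed

lemma cancel_irreducible:
  assumes "a \<in> A" "a \<noteq> 0" "irreducible r" "a = r * a'"
  shows "a' \<in> A" "a' \<noteq> 0" "r \<in> A" "\<delta> a' < \<delta> a"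
proof -
  show *: "a' \<in> A" "a' \<noteq> 0" "r \<in> A" using factors_in[OF assms(1,2,4)] by auto
  have "r \<noteq> 0" "\<not> r dvd 1" using assms by (auto simp: irreducible_def)
  then show "\<delta> a' < \<delta> a" using * length_mult[of r a'] length_0[of r] assms(4) by simp
qed

text \<open>Induction on the length of \<open>a\<close>: an irreducible factor \<open>r\<close> of
  \<open>a\<close> divides \<open>b * c\<close> but not \<open>b\<close>, hence divides
  \<open>c\<close>, and \<open>r\<close> can be cancelled from both \<open>a\<close> and
  \<open>c\<close>.\<close>

lemma dvd_mult_cancel_coprime:
  assumes "a \<in> A" "b \<in> A" "c \<in> A" "a \<noteq> 0"
    and "\<And>r. r \<in> A \<Longrightarrow> irreducible r \<Longrightarrow> r dvd a \<Longrightarrow> \<not> r dvd b"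
    and "a dvd b * c"
  shows "a dvd c"
  using assms
proof (induction "\<delta> a" arbitrary: a c rule: less_induct)
  case less
  consider "a dvd 1" | "c = 0" | "\<not> a dvd 1" "c \<noteq> 0" by blast
  then show ?case
  proof cases
    case 3
    then obtain r where r: "r \<in> A" "irreducible r" "r dvd a"
      using irreducible_factor_exists less.prems by blast
    then have "\<not> r dvd b" "r dvd b * c" using less.prems by (auto intro: dvd_trans)
    then have "r dvd c" using irreducible_dvd_mult r less.prems by blast
    with r obtain a' c' where eq: "a = r * a'" "c = r * c'" by (auto elim!: dvdE)
    have r0: "r \<noteq> 0" using r by (auto simp: irreducible_def)
    have "r * a' dvd r * (b * c')" using less.prems(6) eq by (simp add: ac_simps)
    then have "a' dvd b * c'" using r0 by simp
    moreover have "c' \<in> A" using factors_in(2)[OF less.prems(3) _ eq(2)] 3 by blast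
    moreover have "\<not> s dvd b" if "s \<in> A" "irreducible s" "s dvd a'" for s
      using less.prems(5)[of s] that eq by simp
    ultimately have "a' dvd c'"
      using less.hyps[of a' c'] cancel_irreducible[OF less.prems(1,4) r(2) eq(1)] less.prems(2) by blast
    then show ?thesis using eq by simp
  qed (auto intro: dvd_trans)
qed

lemma irreducible_dvd_prod:
  assumes "finite S" "\<And>i. i \<in> S \<Longrightarrow> f i \<in> A" "r \<in> A" "irreducible r" "r dvd (\<Prod>i\<in>S. f i)"
  shows "\<exists>i\<in>S. r dvd f i"
  using assms
proof (induction S)
  case empty
  then show ?case by (auto simp: irreducible_def)
next
  case (insert i S)
  have "prod f T \<in> A" if "T \<subseteq> S" for T
    using that insert.prems(1) by (induction T rule: infinite_finite_induct) (auto simp: one_in mult_in)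
  then have "prod f S \<in> A" by blast
  with insert show ?case using irreducible_dvd_mult[of r "f i" "prod f S"] by auto
qed

lemma irreducible_dvd_power:
  assumes "a \<in> A" "r \<in> A" "irreducible r" "r dvd a ^ n"
  shows "r dvd a"
  using irreducible_dvd_prod[of "{..<n}" "\<lambda>_. a" r] assms by auto

end

section \<open>Adjoining one variable: Gauss's lemma and primality of irreducibles\<close>

locale adjoin_variable = factorial_subring "Collect (in_ring X)" \<delta>
  for X :: "(nat \<times> nat) set" and \<delta> :: "'a::idom mpoly \<Rightarrow> nat" +
  fixes v assumes v: "v \<notin> X"
begin

lemma in_ring_insert: "in_ring X a \<Longrightarrow> in_ring (insert v X) a"
  by (auto simp: in_ring_def)

lemma drop_leading_term:
  fixes y :: "'a mpoly"
  assumes "in_ring (insert v X) y" "y \<noteq> 0"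
  defines "y' \<equiv> y - mlead v y * mvar v ^ mdeg v y"
  shows "in_ring (insert v X) y'" and "y' \<noteq> 0 \<Longrightarrow> mdeg v y' < mdeg v y"
proof -
  have L: "in_ring X (mlead v y)" using assms(1) by (rule in_ring_mlead)
  show "in_ring (insert v X) y'"
    unfolding y'_def
    by (intro in_ring_diff[OF assms(1)] in_ring_mult in_ring_insert[OF L] in_ring_power in_ring_mvar) auto
  show "mdeg v y' < mdeg v y" if "y' \<noteq> 0"
    unfolding y'_def
    by (rule mdeg_diff_less)
       (use that assms(2) L v in \<open>auto simp: y'_def mdeg_term[OF L v] mlead_term[OF L v]\<close>)
qed

text \<open>Irreducible constants stay prime. By primality in \<open>R[X]\<close>, \<open>r\<close>
  divides one of the two leading coefficients; removing that leading term keeps the product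
  divisible by \<open>r\<close> and lowers the total degree.\<close>

lemma gauss:
  fixes r y z :: "'a mpoly"
  assumes r: "in_ring X r" "irreducible r"
    and "in_ring (insert v X) y" "in_ring (insert v X) z" "r dvd y * z"
  shows "r dvd y \<or> r dvd z"
  using assms(3-)
proof (induction "mdeg v y + mdeg v z" arbitrary: y z rule: less_induct)
  case less
  have step: "r dvd a \<or> r dvd b"
    if ab: "mdeg v a + mdeg v b = mdeg v y + mdeg v z" "in_ring (insert v X) a"
      "in_ring (insert v X) b" "a \<noteq> 0" "r dvd a * b" and lead: "r dvd mlead v a" for a b
  proof -
    let ?a = "a - mlead v a * mvar v ^ mdeg v a"
    have "r dvd ?a * b" using ab lead
      by (simp add: left_diff_distrib)
    then have "r dvd ?a \<or> r dvd b"
      using drop_leading_term[OF ab(2,4)] less.hyps[of ?a b] ab by (cases "?a = 0") auto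
    moreover have "r dvd a" if "r dvd ?a"
      using dvd_add[OF that dvd_mult2[OF lead, of "mvar v ^ mdeg v a"]] by simp
    ultimately show ?thesis by blast
  qed
  show ?case
  proof (cases "y = 0 \<or> z = 0")
    case False
    obtain w where w: "y * z = r * w" using less.prems by (auto elim: dvdE)
    \<comment> \<open>Leading coefficients multiply, and \<open>r\<close>, being free of
      \<open>v\<close>, is its own leading coefficient.\<close>
    have "mlead v y * mlead v z = r * mlead v w"
      by (metis w mlead_mult mlead_const r(1) v)
    then have "r dvd mlead v y \<or> r dvd mlead v z"
      using irreducible_dvd_mult[of r "mlead v y" "mlead v z"] r less.prems
      by (auto simp: in_ring_mlead)
    then show ?thesis
      using step[of y z] step[of z y] less.prems False by (auto simp: mult.commute add.commute)
  qed auto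
qed

text \<open>Division with remainder is possible once the dividend may be scaled by constants:
  multiplying by the leading coefficient of \<open>h\<close> avoids dividing by it. A zero remainder
  is a separate alternative because its degree counts as 0.\<close>

lemma pseudo_division:
  fixes h y :: "'a mpoly"
  assumes "in_ring (insert v X) h" "h \<noteq> 0" "in_ring (insert v X) y"
  shows "\<exists>l u. in_ring X l \<and> l \<noteq> 0 \<and> in_ring (insert v X) u \<and>
           (l * y - u * h = 0 \<or> mdeg v (l * y - u * h) < mdeg v h)"
  using assms(3)
proof (induction "mdeg v y" arbitrary: y rule: less_induct)
  case less
  show ?case
  proof (cases "y = 0 \<or> mdeg v y < mdeg v h")
    case True
    then show ?thesis by (intro exI[of _ 1] exI[of _ 0]) auto
  next
    case False
    define e where "e = mdeg v y - mdeg v h"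
    have L: "in_ring X (mlead v h)" "in_ring X (mlead v y)"
      using assms less.prems by (auto intro: in_ring_mlead)
    define t where "t = mlead v y * mvar v ^ e"
    \<comment> \<open>The term \<open>t\<close> is chosen such that both products have the same
      degree and the same leading coefficient, so the top terms cancel.\<close>
    define y1 where "y1 = mlead v h * y - t * h"
    have y0: "mlead v y \<noteq> 0" using False by simp
    have t: "in_ring (insert v X) t" "mdeg v t = e" "mlead v t = mlead v y"
      unfolding t_def using mdeg_term[OF L(2) v y0] mlead_term[OF L(2) v]
      by (auto intro!: in_ring_mult in_ring_insert[OF L(2)] in_ring_power in_ring_mvar)
    have "t \<noteq> 0" using t(3) False by (metis mlead_eq_0_iff)
    note t = t this
    have y1: "in_ring (insert v X) y1"
      unfolding y1_def using L t assms less.prems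
      by (intro in_ring_diff in_ring_mult) (auto intro: in_ring_insert)
    have less_y1: "mdeg v y1 < mdeg v y" if "y1 \<noteq> 0"
    proof -
      have "mdeg v (mlead v h * y) = mdeg v y"
        using False assms L v by (simp add: mdeg_mult mdeg_const)
      moreover have "mdeg v (t * h) = mdeg v y"
        using False assms t by (simp add: mdeg_mult e_def)
      moreover have "mlead v (mlead v h * y) = mlead v (t * h)"
        using L v t by (simp add: mlead_mult mlead_const)
      ultimately show ?thesis
        using mdeg_diff_less[of v "mlead v h * y" "t * h"] that by (auto simp: y1_def)
    qed
    have "\<exists>l u. in_ring X l \<and> l \<noteq> 0 \<and> in_ring (insert v X) u \<and>
           (l * y1 - u * h = 0 \<or> mdeg v (l * y1 - u * h) < mdeg v h)"
    proof (cases "y1 = 0")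
      case True
      then show ?thesis by (intro exI[of _ 1] exI[of _ 0]) auto
    qed (use less.hyps[of y1] less_y1 y1 in auto)
    then obtain l u where lu: "in_ring X l" "l \<noteq> 0" "in_ring (insert v X) u"
      "l * y1 - u * h = 0 \<or> mdeg v (l * y1 - u * h) < mdeg v h" by blast
    have eq: "(l * mlead v h) * y - (l * t + u) * h = l * y1 - u * h"
      by (simp add: y1_def algebra_simps)
    have "in_ring (insert v X) (l * t + u)"
      using lu t by (intro in_ring_add in_ring_mult) (auto intro: in_ring_insert)
    moreover have "l * mlead v h \<noteq> 0" using lu assms by simp
    ultimately show ?thesis using lu L eq
      by (intro exI[of _ "l * mlead v h"] exI[of _ "l * t + u"]) (simp add: in_ring_mult)
  qed
qed

text \<open>Irreducible factors \<open>s\<close> are removed from \<open>a\<close> one at a time: in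
  \<open>a * y = r * z\<close>, Gauss's lemma moves \<open>s\<close> into \<open>z\<close>, since
  \<open>s\<close> does not divide the primitive \<open>r\<close>.\<close>

lemma cancel_constant:
  fixes r y a :: "'a mpoly"
  assumes "in_ring (insert v X) r" "in_ring (insert v X) y" "r \<noteq> 0"
    and prim: "\<And>s. in_ring X s \<Longrightarrow> irreducible s \<Longrightarrow> \<not> s dvd r"
    and "in_ring X a" "a \<noteq> 0" "r dvd a * y"
  shows "r dvd y"
  using assms(5-)
proof (induction "\<delta> a" arbitrary: a rule: less_induct)
  case less
  show ?case
  proof (cases "a dvd 1 \<or> y = 0")
    case True
    then show ?thesis
    proof
      assume "a dvd 1"
      then obtain b where b: "1 = a * b" by (auto elim: dvdE)
      have "b * (a * y) = a * b * y" by (simp add: ac_simps)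
      then have eq: "b * (a * y) = y" unfolding b[symmetric] by simp
      have "r dvd b * (a * y)" using less.prems(3) by (rule dvd_mult)
      then show ?thesis unfolding eq .
    qed auto
  next
    case False
    then obtain s where s: "in_ring X s" "irreducible s" "s dvd a"
      using irreducible_factor_exists[of a] less.prems by auto
    obtain a' where a': "a = s * a'" using s by (auto elim: dvdE)
    note a'_props = cancel_irreducible[OF _ less.prems(2) s(2) a', simplified, OF less.prems(1)]
    obtain z where z: "a * y = r * z" using less.prems by (auto elim: dvdE)
    have ay: "a * y \<noteq> 0" "in_ring (insert v X) (a * y)"
      using False less.prems assms(2) by (auto intro: in_ring_mult in_ring_insert)
    then have "in_ring (insert v X) z" using z in_ring_dvd[of z "a * y"] by auto
    moreover have "s dvd r * z" using s z by (metis dvd_mult2)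
    ultimately have "s dvd z" using gauss[OF s(1,2) assms(1)] prim s by blast
    then obtain z' where "z = s * z'" by (auto elim: dvdE)
    then have "s * (a' * y) = s * (r * z')" using z a' by (simp add: ac_simps)
    then have "a' * y = r * z'" using s by (auto simp: irreducible_def)
    then show ?thesis using less.hyps[of a'] a'_props by auto
  qed
qed

text \<open>Gauss's lemma lets each irreducible factor of \<open>l\<close> be cancelled from
  \<open>h\<close> or from \<open>g\<close>. Once \<open>l\<close> is a unit, \<open>h\<close>
  divides the irreducible \<open>r\<close> and is not a unit, having positive degree, so
  \<open>h\<close> and \<open>r\<close> are associated.\<close>

lemma irreducible_dvd_factor:
  fixes r l h g :: "'a mpoly"
  assumes "in_ring (insert v X) r" "irreducible r" "in_ring X l" "l \<noteq> 0" "h * g = l * r" "mdeg v h > 0"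
  shows "r dvd h"
  using assms(3-)
proof (induction "\<delta> l" arbitrary: l h g rule: less_induct)
  case less
  have r0: "r \<noteq> 0" using assms by (auto simp: irreducible_def)
  have hg0: "h * g \<noteq> 0" using less.prems r0 by simp
  have hg: "in_ring (insert v X) h" "in_ring (insert v X) g"
    using in_ring_dvd[of h "h * g" "insert v X"] in_ring_dvd[of g "h * g" "insert v X"] hg0
      in_ring_mult[OF in_ring_insert[OF less.prems(1)] assms(1)]
    unfolding less.prems(3)[symmetric] by auto
  show ?case
  proof (cases "l dvd 1")
    case True
    then obtain b where b: "1 = l * b" by (auto elim: dvdE)
    have "l * b * r = b * (l * r)" by (simp add: ac_simps)
    then have "r = b * (l * r)" unfolding b[symmetric] by simp
    then have r_eq: "r = h * (g * b)" using less.prems by (simp add: ac_simps)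
    then have "h dvd 1 \<or> g * b dvd 1" using assms(2) by (auto simp: irreducible_def)
    moreover have "\<not> h dvd 1" using mdeg_unit[of h v] less.prems by auto
    ultimately obtain c where c: "1 = g * b * c" by (auto elim: dvdE)
    have "h = h * (g * b * c)" unfolding c[symmetric] by simp
    also have "\<dots> = r * c" by (subst r_eq) (simp only: ac_simps)
    finally show ?thesis by (rule dvdI)
  next
    case False
    then obtain s where s: "in_ring X s" "irreducible s" "s dvd l"
      using irreducible_factor_exists[of l] less.prems by auto
    have s0: "s \<noteq> 0" using s by (auto simp: irreducible_def)
    obtain l' where l': "l = s * l'" using s by (auto elim: dvdE)
    note l'_props = cancel_irreducible[OF _ less.prems(2) s(2) l', simplified, OF less.prems(1)]
    have "s dvd h * g" using less.prems l' by simp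
    then consider "s dvd h" | "s dvd g" using gauss[OF s(1,2) hg] by blast
    then show ?thesis
    proof cases
      case 1
      then obtain h' where h': "h = s * h'" by (auto elim: dvdE)
      have "s * (h' * g) = s * (l' * r)" using less.prems(3) h' l' by (simp add: ac_simps)
      then have "h' * g = l' * r" using s0 by auto
      moreover have "mdeg v h' > 0"
        using less.prems(4) hg0 h' s0 mdeg_mult[of s h' v] mdeg_const[OF s(1) v] by auto
      ultimately have "r dvd h'" using less.hyps[of l' h' g] l'_props by auto
      then show ?thesis using h' by simp
    next
      case 2
      then obtain g' where g': "g = s * g'" by (auto elim: dvdE)
      have "s * (h * g') = s * (l' * r)" using less.prems(3) g' l' by (simp add: ac_simps)
      then have "h * g' = l' * r" using s0 by auto
      then show ?thesis using less.hyps[of l' h g'] l'_props less.prems(4) by auto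
    qed
  qed
qed

text \<open>The Euclidean argument: take an element of least degree in the ideal generated by \<open>r\<close>
  and \<open>b\<close>. If it is constant it can be cancelled because \<open>r\<close> is primitive; otherwise it divides
  constant multiples of \<open>r\<close> and \<open>b\<close>, hence is itself a multiple of \<open>r\<close>.\<close>

lemma irreducible_dvd_mult_insert:
  fixes r b c :: "'a mpoly"
  assumes r: "in_ring (insert v X) r" "irreducible r"
    and b: "in_ring (insert v X) b" and c: "in_ring (insert v X) c" and "r dvd b * c"
  shows "r dvd b \<or> r dvd c"
proof (cases "mdeg v r = 0")
  case True
  then have "in_ring X r" using in_ring_mlead[OF r(1)] mlead_eq_self[of v r] by simp
  then show ?thesis using gauss assms by blast
next
  case False
  have r0: "r \<noteq> 0" using r by (auto simp: irreducible_def)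
  \<comment> \<open>An irreducible constant dividing \<open>r\<close> would leave a unit as
    cofactor, and \<open>r\<close> would have degree 0.\<close>
  have prim: "\<not> s dvd r" if s: "in_ring X s" "irreducible s" for s
  proof
    assume "s dvd r"
    then obtain e where e: "r = s * e" by (auto elim: dvdE)
    then have "e dvd 1" using r(2) s(2) by (auto simp: irreducible_def)
    then have "mdeg v r = 0" using e r0 mdeg_unit[of e] mdeg_const[OF s(1) v] by (simp add: mdeg_mult)
    with False show False by simp
  qed
  define J where "J = (\<lambda>h. \<exists>s t. in_ring (insert v X) s \<and> in_ring (insert v X) t \<and> h = s * r + t * b)"
  have J_in: "in_ring (insert v X) h" if "J h" for h
    using that r b by (auto simp: J_def intro!: in_ring_add in_ring_mult)
  have J_comb: "J (l * y - u * h)"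
    if yh: "J y" "J h" and lu: "in_ring (insert v X) l" "in_ring (insert v X) u" for l y u h
  proof -
    obtain s t s' t' where *: "y = s * r + t * b" "h = s' * r + t' * b" "in_ring (insert v X) s"
      "in_ring (insert v X) t" "in_ring (insert v X) s'" "in_ring (insert v X) t'"
      using yh unfolding J_def by blast
    have "l * y - u * h = (l * s - u * s') * r + (l * t - u * t') * b"
      by (simp add: * algebra_simps)
    then show ?thesis unfolding J_def using lu *
      by (intro exI[of _ "l * s - u * s'"] exI[of _ "l * t - u * t'"])
        (auto intro!: in_ring_diff in_ring_mult)
  qed
  have Jr: "J r" unfolding J_def by (intro exI[of _ 1] exI[of _ 0]) simp
  have Jb: "J b" unfolding J_def by (intro exI[of _ 0] exI[of _ 1]) simp
  obtain h where h: "J h" "h \<noteq> 0" and min: "\<And>y. J y \<Longrightarrow> y \<noteq> 0 \<Longrightarrow> mdeg v h \<le> mdeg v y"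
    using ex_has_least_nat[of "\<lambda>y. J y \<and> y \<noteq> 0" r "mdeg v"] Jr r0 by blast
  \<comment> \<open>The pseudo-remainder of \<open>y\<close> by \<open>h\<close> lies in the ideal
    again, so minimality of the degree of \<open>h\<close> forces it to be 0.\<close>
  have multiple: "\<exists>l u. in_ring X l \<and> l \<noteq> 0 \<and> l * y = h * u" if y: "J y" for y
  proof -
    obtain l u where lu: "in_ring X l" "l \<noteq> 0" "in_ring (insert v X) u"
      "l * y - u * h = 0 \<or> mdeg v (l * y - u * h) < mdeg v h"
      using pseudo_division[OF J_in[OF h(1)] h(2) J_in[OF y]] by blast
    have "J (l * y - u * h)" by (rule J_comb) (use y h lu in_ring_insert in auto)
    then have "l * y - u * h = 0" using lu(4) min[of "l * y - u * h"] by fastforce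
    then have "l * y = h * u" by (simp add: mult.commute)
    then show ?thesis using lu by blast
  qed
  show ?thesis
  proof (cases "mdeg v h = 0")
    case True
    obtain s t where st: "h = s * r + t * b" using h(1) unfolding J_def by blast
    have "in_ring X h" using True in_ring_mlead[OF J_in[OF h(1)]] mlead_eq_self[of v h] by simp
    moreover have "h * c = r * (s * c) + t * (b * c)" by (simp add: st algebra_simps)
    then have "r dvd h * c" using assms(5) by (metis dvd_add dvd_mult dvd_triv_left)
    ultimately have "r dvd c" using cancel_constant[OF r(1) c r0 prim] h(2) by blast
    then show ?thesis ..
  next
    case False
    obtain l u where lu: "in_ring X l" "l \<noteq> 0" "h * u = l * r" using multiple[OF Jr] by metis
    have "r dvd h" using irreducible_dvd_factor[OF r lu] False by simp
    obtain l' u' where l'u': "in_ring X l'" "l' \<noteq> 0" "l' * b = h * u'" using multiple[OF Jb] by metis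
    have "r dvd l' * b" using \<open>r dvd h\<close> l'u'(3) by simp
    then have "r dvd b" using cancel_constant[OF r(1) b r0 prim l'u'(1,2)] by blast
    then show ?thesis ..
  qed
qed

text \<open>Degree and length of the leading coefficient are both additive; if both vanish, the
  element is its own leading coefficient and a unit. The sum bounds the number of irreducible
  factors from above, which is enough for the descents.\<close>

lemma factorial_subring_insert:
  "factorial_subring (Collect (in_ring (insert v X))) (\<lambda>p. mdeg v p + \<delta> (mlead v p))"
proof
  fix a b :: "'a mpoly"
  assume ab: "a \<in> Collect (in_ring (insert v X))" "b \<in> Collect (in_ring (insert v X))" "a \<noteq> 0" "b \<noteq> 0"
  show "mdeg v (a * b) + \<delta> (mlead v (a * b))
      = mdeg v a + \<delta> (mlead v a) + (mdeg v b + \<delta> (mlead v b))"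
    using ab length_mult[of "mlead v a" "mlead v b"] by (simp add: mdeg_mult mlead_mult in_ring_mlead)
next
  fix a :: "'a mpoly"
  assume a: "a \<in> Collect (in_ring (insert v X))" "a \<noteq> 0"
  have "\<delta> (mlead v a) = 0 \<longleftrightarrow> mlead v a dvd 1"
    using a length_0[of "mlead v a"] by (simp add: in_ring_mlead)
  then show "mdeg v a + \<delta> (mlead v a) = 0 \<longleftrightarrow> a dvd 1"
    using mlead_eq_self[of v a] mdeg_unit[of a v] by auto
next
  fix a b :: "'a mpoly"
  assume "a * b \<in> Collect (in_ring (insert v X))" "a * b \<noteq> 0"
  then show "a \<in> Collect (in_ring (insert v X))" using in_ring_factor by blast
qed (use irreducible_dvd_mult_insert in \<open>auto intro: in_ring_mult\<close>)

end

section \<open>Constants as base case, and induction on the set of variables\<close>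

lemma in_ring_empty_iff: "in_ring {} p \<longleftrightarrow> (\<exists>c. p = Poly_Mapping.single 0 c)"
proof
  assume "in_ring {} p"
  then have "Poly_Mapping.keys p \<subseteq> {0}" by (auto simp: in_ring_iff)
  then have "p = Poly_Mapping.single 0 (Poly_Mapping.lookup p 0)"
    by (intro poly_mapping_eqI) (auto simp: lookup_single when_def in_keys_iff)
  then show "\<exists>c. p = Poly_Mapping.single 0 c" ..
qed (auto intro: in_ring_single)

text \<open>The cofactor of a nonzero constant is itself constant by \<open>in_ring_dvd\<close>, so
  no new divisibility arises in the polynomial ring.\<close>

lemma const_dvd_const_iff:
  "Poly_Mapping.single 0 a dvd (Poly_Mapping.single 0 b :: 'a::idom mpoly) \<longleftrightarrow> a dvd b"
proof
  assume *: "Poly_Mapping.single 0 a dvd (Poly_Mapping.single 0 b :: 'a mpoly)"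
  show "a dvd b"
  proof (cases "b = 0")
    case False
    obtain e where e: "Poly_Mapping.single 0 b = Poly_Mapping.single 0 a * (e :: 'a mpoly)"
      using * by (auto elim: dvdE)
    have "e dvd Poly_Mapping.single 0 b" using e by simp
    moreover have "Poly_Mapping.single 0 b \<noteq> (0 :: 'a mpoly)"
      using False by (metis lookup_single_eq lookup_zero)
    ultimately have "in_ring {} e" using in_ring_dvd[of e "Poly_Mapping.single 0 b"]
      by (auto simp: in_ring_single)
    then obtain c where "e = Poly_Mapping.single 0 c" by (auto simp: in_ring_empty_iff)
    with e have "Poly_Mapping.single 0 b = (Poly_Mapping.single 0 (a * c) :: 'a mpoly)"
      by (simp add: mult_single)
    then have "b = a * c" by (metis lookup_single_eq)
    then show ?thesis by simp
  qed simp
next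
  assume "a dvd b"
  then obtain c where "b = a * c" by (auto elim: dvdE)
  then have "(Poly_Mapping.single 0 b :: 'a mpoly) = Poly_Mapping.single 0 a * Poly_Mapping.single 0 c"
    by (simp add: mult_single)
  then show "Poly_Mapping.single 0 a dvd (Poly_Mapping.single 0 b :: 'a mpoly)" by simp
qed

lemma single_0_eq_iff: "Poly_Mapping.single k c = 0 \<longleftrightarrow> c = 0"
  by (metis lookup_single_eq lookup_zero single_zero)

text \<open>The length is the number of prime factors with multiplicity, and primality of
  irreducibles is inherited from the coefficient ring.\<close>

lemma factorial_subring_constants:
  "factorial_subring (Collect (in_ring {} :: 'a::{factorial_semiring, idom} mpoly \<Rightarrow> bool))
     (\<lambda>p. size (prime_factorization (Poly_Mapping.lookup p 0)))"
proof
  fix r a b :: "'a mpoly"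
  assume "r \<in> Collect (in_ring {})" "a \<in> Collect (in_ring {})" "b \<in> Collect (in_ring {})"
    and irr: "irreducible r" and dvd: "r dvd a * b"
  then obtain r' a' b' where eq: "r = Poly_Mapping.single 0 r'" "a = Poly_Mapping.single 0 a'"
    "b = Poly_Mapping.single 0 b'" by (auto simp: in_ring_empty_iff)
  have unit: "Poly_Mapping.single 0 x dvd (1 :: 'a mpoly) \<longleftrightarrow> x dvd 1" for x :: 'a
    using const_dvd_const_iff[of x 1] by simp
  have "irreducible r'"
  proof (rule irreducibleI)
    show "r' \<noteq> 0" "\<not> r' dvd 1" using irr unit[of r'] eq(1) by (auto simp: irreducible_def)
    fix x y assume "r' = x * y"
    then have "r = Poly_Mapping.single 0 x * Poly_Mapping.single 0 y" by (simp add: eq mult_single)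
    then show "x dvd 1 \<or> y dvd 1" using irr unit by (auto simp: irreducible_def)
  qed
  then have "prime_elem r'" by (rule irreducible_imp_prime_elem)
  moreover have "r' dvd a' * b'" using dvd const_dvd_const_iff[of r' "a' * b'"] by (simp add: eq mult_single)
  ultimately have "r' dvd a' \<or> r' dvd b'" by (rule prime_elem_dvd_multD)
  then show "r dvd a \<or> r dvd b" by (simp add: eq const_dvd_const_iff)
next
  fix a :: "'a mpoly"
  assume "a \<in> Collect (in_ring {})" "a \<noteq> 0"
  then obtain a' where "a = Poly_Mapping.single 0 a'" "a' \<noteq> 0"
    by (auto simp: in_ring_empty_iff single_0_eq_iff)
  then show "size (prime_factorization (Poly_Mapping.lookup a 0)) = 0 \<longleftrightarrow> a dvd 1"
    using const_dvd_const_iff[of a' 1] by (simp add: prime_factorization_empty_iff)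
next
  fix a b :: "'a mpoly"
  assume "a * b \<in> Collect (in_ring {})" "a * b \<noteq> 0"
  then show "a \<in> Collect (in_ring {})" using in_ring_factor by blast
next
  fix a b :: "'a mpoly"
  assume "a \<in> Collect (in_ring {})" "b \<in> Collect (in_ring {})" "a \<noteq> 0" "b \<noteq> 0"
  then obtain a' b' where "a = Poly_Mapping.single 0 a'" "b = Poly_Mapping.single 0 b'"
    "a' \<noteq> 0" "b' \<noteq> 0"
    by (auto simp: in_ring_empty_iff single_0_eq_iff)
  then show "size (prime_factorization (Poly_Mapping.lookup (a * b) 0))
      = size (prime_factorization (Poly_Mapping.lookup a 0))
      + size (prime_factorization (Poly_Mapping.lookup b 0))"
    by (simp add: mult_single prime_factorization_mult)
qed (auto intro: in_ring_mult)

lemma factorial_subring_in_ring: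
  assumes "finite X"
  shows "\<exists>\<delta>. factorial_subring (Collect (in_ring X :: 'a::{factorial_semiring, idom} mpoly \<Rightarrow> bool)) \<delta>"
  using assms
proof (induction X)
  case empty
  show ?case using factorial_subring_constants by blast
next
  case (insert v X)
  then obtain \<delta> where "factorial_subring (Collect (in_ring X :: 'a mpoly \<Rightarrow> bool)) \<delta>" by blast
  then interpret adjoin_variable X \<delta> v
    using insert.hyps by (simp add: adjoin_variable_def adjoin_variable_axioms_def)
  show ?case using factorial_subring_insert by blast
qed

section \<open>Laurent elements of the fraction field\<close>

lemma meval_altdef: "meval f p = mpoly_eval (\<lambda>c. to_frac (Poly_Mapping.single 0 c)) f p"
  by (simp add: meval_def mpoly_eval_def mono_eval_def)

lemma to_frac_coefficient_hom:
  "coefficient_hom (\<lambda>c::'a::idom. to_frac (Poly_Mapping.single (0 :: (nat \<times> nat) \<Rightarrow>\<^sub>0 nat) c))"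
  by unfold_locales (simp_all add: Zero_fract_def One_fract_def single_add mult_single)

lemma meval_0 [simp]: "meval f 0 = 0"
  by (simp add: meval_def)

lemma meval_1 [simp]: "meval f 1 = 1"
  unfolding meval_altdef by (rule coefficient_hom.eval_one[OF to_frac_coefficient_hom])

lemma meval_add: "meval f (p + q) = meval f p + meval f q"
  unfolding meval_altdef by (rule coefficient_hom.eval_add[OF to_frac_coefficient_hom])

lemma meval_mult: "meval f (p * q) = meval f p * meval f q"
  unfolding meval_altdef by (rule coefficient_hom.eval_mult[OF to_frac_coefficient_hom])

lemma meval_mvar: "meval f (mvar v) = f v"
  unfolding meval_altdef mvar_def by (rule coefficient_hom.eval_var[OF to_frac_coefficient_hom])

lemma meval_const: "meval f (Poly_Mapping.single 0 c) = to_frac (Poly_Mapping.single 0 c)"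
  unfolding meval_altdef by (subst coefficient_hom.eval_single[OF to_frac_coefficient_hom]) simp

lemma meval_monom: "meval f (Poly_Mapping.single m 1) = mono_eval f m"
  unfolding meval_altdef
  by (subst coefficient_hom.eval_single[OF to_frac_coefficient_hom]) (simp add: One_fract_def)

text \<open>For \<open>V \<subseteq> U\<close> this is \<open>R[U - V]\<close> with the variables of
  \<open>V\<close> inverted. Denominators have coefficient 1; unit coefficients are absorbed into
  the numerator.\<close>

definition laurent :: "(nat \<times> nat) set \<Rightarrow> (nat \<times> nat) set \<Rightarrow> 'a::idom mpoly fract set" where
  "laurent U V = {Fract f (Poly_Mapping.single m 1) | f m. in_ring U f \<and> Poly_Mapping.keys m \<subseteq> V}"

lemma laurentI: "in_ring U f \<Longrightarrow> Poly_Mapping.keys m \<subseteq> V \<Longrightarrow> Fract f (Poly_Mapping.single m 1) \<in> laurent U V"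
  by (auto simp: laurent_def)

lemma laurentE:
  assumes "z \<in> laurent U V"
  obtains f m where "in_ring U f" "Poly_Mapping.keys m \<subseteq> V" "z = Fract f (Poly_Mapping.single m 1)"
  using assms by (auto simp: laurent_def)

lemma to_frac_in_laurent: "in_ring U f \<Longrightarrow> to_frac f \<in> laurent U V"
  using laurentI[of U f 0 V] by simp

lemma zero_in_laurent: "0 \<in> laurent U V" and one_in_laurent: "1 \<in> laurent U V"
  using to_frac_in_laurent[of U 0 V] to_frac_in_laurent[of U 1 V]
  by (simp_all add: Zero_fract_def One_fract_def)

lemma add_in_laurent:
  assumes "V \<subseteq> U" "z \<in> laurent U V" "w \<in> laurent U V"
  shows "z + w \<in> laurent U V"
proof -
  obtain f m where z: "in_ring U f" "Poly_Mapping.keys m \<subseteq> V" "z = Fract f (Poly_Mapping.single m 1)"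
    using assms by (auto elim: laurentE)
  obtain g n where w: "in_ring U g" "Poly_Mapping.keys n \<subseteq> V" "w = Fract g (Poly_Mapping.single n 1)"
    using assms by (auto elim: laurentE)
  have "z + w = Fract (f * Poly_Mapping.single n 1 + g * Poly_Mapping.single m 1) (Poly_Mapping.single (m + n) 1)"
    by (simp add: z w single_0_eq_iff mult_single)
  moreover have "in_ring U (f * Poly_Mapping.single n 1 + g * Poly_Mapping.single m 1)"
    using z w assms(1) by (intro in_ring_add in_ring_mult in_ring_single) auto
  ultimately show ?thesis using z w by (auto intro!: laurentI simp: keys_add_nat)
qed

lemma mult_in_laurent:
  assumes "z \<in> laurent U V" "w \<in> laurent U V"
  shows "z * w \<in> laurent U V"
proof -
  obtain f m where z: "in_ring U f" "Poly_Mapping.keys m \<subseteq> V" "z = Fract f (Poly_Mapping.single m 1)"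
    using assms by (auto elim: laurentE)
  obtain g n where w: "in_ring U g" "Poly_Mapping.keys n \<subseteq> V" "w = Fract g (Poly_Mapping.single n 1)"
    using assms by (auto elim: laurentE)
  have "z * w = Fract (f * g) (Poly_Mapping.single (m + n) 1)"
    by (simp add: z w mult_single)
  then show ?thesis using z w by (auto intro!: laurentI in_ring_mult simp: keys_add_nat)
qed

lemma mono_eval_in_laurent:
  assumes "\<And>v. v \<in> Poly_Mapping.keys m \<Longrightarrow> f v \<in> laurent U V"
  shows "mono_eval f m \<in> laurent U V"
  by (rule rel_mono_eval[where R = "\<lambda>z (w::nat). z \<in> laurent U V" and g' = "\<lambda>_. 0"])
     (use assms in \<open>auto intro: one_in_laurent mult_in_laurent\<close>)

lemma meval_in_laurent:
  assumes "V \<subseteq> U" "in_ring X p" "\<And>v. v \<in> X \<Longrightarrow> f v \<in> laurent U V"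
  shows "meval f p \<in> laurent U V"
  unfolding meval_altdef
proof (rule rel_mpoly_eval[where R = "\<lambda>z (w::nat). z \<in> laurent U V" and g' = "\<lambda>_. 0" and c' = "\<lambda>_. 0"])
  fix v m assume "m \<in> Poly_Mapping.keys p" "v \<in> Poly_Mapping.keys m"
  then have "v \<in> X" using assms(2) by (auto simp: in_ring_iff)
  then show "f v \<in> laurent U V" by (rule assms(3))
qed (use assms(1) in \<open>auto intro: zero_in_laurent one_in_laurent mult_in_laurent add_in_laurent
        intro!: to_frac_in_laurent in_ring_single\<close>)

lemma Fract_monomial_in_laurent:
  assumes "in_ring U f" "is_monomial_in V g"
  shows "Fract f g \<in> laurent U V"
proof -
  obtain c m where cm: "c dvd 1" "Poly_Mapping.keys m \<subseteq> V" "g = Poly_Mapping.single m c"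
    using assms by (auto simp: is_monomial_in_def)
  then obtain c' where c': "1 = c * c'" by (auto elim: dvdE)
  have "Fract f g = Fract (f * Poly_Mapping.single 0 c') (Poly_Mapping.single m 1)"
  proof -
    have "c \<noteq> 0" using c' by auto
    then show ?thesis
      using cm c' by (simp add: eq_fract single_0_eq_iff mult.assoc mult_single) (simp add: mult.commute)
  qed
  then show ?thesis using cm assms(1) by (auto intro!: laurentI in_ring_mult in_ring_single)
qed

text \<open>Write \<open>z\<close> as \<open>a / (M * A)\<close> and as \<open>b / (N * B)\<close>
  with monomials \<open>M\<close>, \<open>N\<close>. Cross-multiplying shows that \<open>A\<close>
  divides \<open>B * (a * N)\<close>, hence \<open>a * N\<close> by coprimality, and the quotient
  \<open>C\<close> gives \<open>z = C / (M * N)\<close>.\<close>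

lemma laurent_coprime_multiples:
  fixes A B :: "'a::{factorial_semiring, idom} mpoly"
  assumes "finite U" "V \<subseteq> U"
    and "in_ring U A" "in_ring U B" "A \<noteq> 0" "B \<noteq> 0"
    and coprime: "\<And>r. in_ring U r \<Longrightarrow> irreducible r \<Longrightarrow> r dvd A \<Longrightarrow> \<not> r dvd B"
    and zA: "z * to_frac A \<in> laurent U V" and zB: "z * to_frac B \<in> laurent U V"
  shows "z \<in> laurent U V"
proof -
  obtain \<delta> where "factorial_subring (Collect (in_ring U :: 'a mpoly \<Rightarrow> bool)) \<delta>"
    using factorial_subring_in_ring[OF assms(1)] by blast
  then interpret factorial_subring "Collect (in_ring U :: 'a mpoly \<Rightarrow> bool)" \<delta> .
  obtain a m where a: "in_ring U a" "Poly_Mapping.keys m \<subseteq> V" "z * to_frac A = Fract a (Poly_Mapping.single m 1)"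
    using zA by (auto elim: laurentE)
  obtain b n where b: "in_ring U b" "Poly_Mapping.keys n \<subseteq> V" "z * to_frac B = Fract b (Poly_Mapping.single n 1)"
    using zB by (auto elim: laurentE)
  define M N where "M = (Poly_Mapping.single m 1 :: 'a mpoly)" and "N = (Poly_Mapping.single n 1 :: 'a mpoly)"
  have nz: "M \<noteq> 0" "N \<noteq> 0" by (simp_all add: M_def N_def single_0_eq_iff)
  have N: "in_ring U N" using b assms(2) by (auto simp: N_def intro: in_ring_single)
  have nzf: "to_frac A \<noteq> 0" "to_frac B \<noteq> 0" using assms(5,6) by (simp_all add: Zero_fract_def eq_fract)
  have zA': "z = Fract a (M * A)"
  proof -
    have "z = z * to_frac A / to_frac A" using nzf by simp
    then show ?thesis unfolding a(3) by (simp add: M_def)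
  qed
  have zB': "z = Fract b (N * B)"
  proof -
    have "z = z * to_frac B / to_frac B" using nzf by simp
    then show ?thesis unfolding b(3) by (simp add: N_def)
  qed
  have "a * (N * B) = b * (M * A)"
    using zA' zB' nz assms(5,6) by (simp add: eq_fract)
  then have "B * (a * N) = A * (b * M)" by (simp add: ac_simps)
  then have "A dvd B * (a * N)" by simp
  then have "A dvd a * N"
    using dvd_mult_cancel_coprime[of A B "a * N"] assms(3-6) coprime a(1) N by (auto intro: in_ring_mult)
  then obtain C where C: "a * N = A * C" by (auto elim: dvdE)
  have "in_ring U C"
  proof (cases "C = 0")
    case False
    then show ?thesis
      using in_ring_dvd[of C "A * C" U] in_ring_mult[OF a(1) N] assms(5) unfolding C by simp
  qed simp
  moreover have "z = Fract C (Poly_Mapping.single (m + n) 1)"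
  proof -
    have "a * (M * N) = M * (a * N)" by (simp add: ac_simps)
    also have "\<dots> = C * (M * A)" unfolding C by (simp add: ac_simps)
    finally have "z = Fract C (M * N)"
      unfolding zA' using nz assms(5) by (simp add: eq_fract)
    then show ?thesis by (simp add: M_def N_def mult_single)
  qed
  ultimately show ?thesis using a b by (auto intro!: laurentI simp: keys_add_nat)
qed

section \<open>Shifting the recurrence\<close>

text \<open>Substituting \<open>\<sigma>\<close> for the variables is only a partial map on the fraction field:
  \<open>specialises \<sigma> z w\<close> states that it is defined at \<open>z\<close>, with value \<open>w\<close>.\<close>

definition specialises ::
    "(nat \<times> nat \<Rightarrow> 'a::idom mpoly fract) \<Rightarrow> 'a mpoly fract \<Rightarrow> 'a mpoly fract \<Rightarrow> bool" where
  "specialises \<sigma> z w \<longleftrightarrow> (\<exists>f g. g \<noteq> 0 \<and> meval \<sigma> g \<noteq> 0 \<and> z = Fract f g \<and> w = meval \<sigma> f / meval \<sigma> g)"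

lemma specialises_to_frac: "specialises \<sigma> (to_frac f) (meval \<sigma> f)"
  unfolding specialises_def by (intro exI[of _ f] exI[of _ 1]) simp

lemma specialises_add:
  assumes "specialises \<sigma> z w" "specialises \<sigma> z' w'"
  shows "specialises \<sigma> (z + z') (w + w')"
proof -
  obtain f g f' g' where *: "g \<noteq> 0" "meval \<sigma> g \<noteq> 0" "z = Fract f g" "w = meval \<sigma> f / meval \<sigma> g"
    "g' \<noteq> 0" "meval \<sigma> g' \<noteq> 0" "z' = Fract f' g'" "w' = meval \<sigma> f' / meval \<sigma> g'"
    using assms unfolding specialises_def by blast
  show ?thesis unfolding specialises_def
    by (intro exI[of _ "f * g' + f' * g"] exI[of _ "g * g'"])
       (use * in \<open>simp add: meval_add meval_mult add_frac_eq\<close>)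
qed

lemma specialises_mult:
  assumes "specialises \<sigma> z w" "specialises \<sigma> z' w'"
  shows "specialises \<sigma> (z * z') (w * w')"
proof -
  obtain f g f' g' where *: "g \<noteq> 0" "meval \<sigma> g \<noteq> 0" "z = Fract f g" "w = meval \<sigma> f / meval \<sigma> g"
    "g' \<noteq> 0" "meval \<sigma> g' \<noteq> 0" "z' = Fract f' g'" "w' = meval \<sigma> f' / meval \<sigma> g'"
    using assms unfolding specialises_def by blast
  show ?thesis unfolding specialises_def
    by (intro exI[of _ "f * f'"] exI[of _ "g * g'"]) (use * in \<open>simp add: meval_mult\<close>)
qed

text \<open>If \<open>w'\<close> is nonzero, then so is the numerator of \<open>z'\<close>, before
  and after substitution, and it can serve as a new denominator.\<close>

lemma specialises_divide:
  assumes "specialises \<sigma> z w" "specialises \<sigma> z' w'" "w' \<noteq> 0"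
  shows "specialises \<sigma> (z / z') (w / w')"
proof -
  obtain f g f' g' where *: "g \<noteq> 0" "meval \<sigma> g \<noteq> 0" "z = Fract f g" "w = meval \<sigma> f / meval \<sigma> g"
    "g' \<noteq> 0" "meval \<sigma> g' \<noteq> 0" "z' = Fract f' g'" "w' = meval \<sigma> f' / meval \<sigma> g'"
    using assms unfolding specialises_def by blast
  have "meval \<sigma> f' \<noteq> 0" "f' \<noteq> 0" using * assms(3) by auto
  then show ?thesis unfolding specialises_def
    by (intro exI[of _ "f * g'"] exI[of _ "g * f'"]) (use * in \<open>simp add: meval_mult\<close>)
qed

text \<open>Independence of the chosen fraction, by cross-multiplying with the one that witnesses
  the specialisation. The equation avoids division because \<open>meval \<sigma> g\<close> may
  vanish.\<close>

lemma specialises_Fract: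
  assumes "specialises \<sigma> (Fract f g) w" "g \<noteq> 0"
  shows "w * meval \<sigma> g = meval \<sigma> f"
proof -
  obtain f' g' where *: "g' \<noteq> 0" "meval \<sigma> g' \<noteq> 0" "Fract f g = Fract f' g'" "w = meval \<sigma> f' / meval \<sigma> g'"
    using assms unfolding specialises_def by blast
  then have "f * g' = f' * g" using assms(2) by (simp add: eq_fract)
  then have "meval \<sigma> f * meval \<sigma> g' = meval \<sigma> f' * meval \<sigma> g" by (simp flip: meval_mult)
  moreover have "meval \<sigma> f' = w * meval \<sigma> g'" using * by simp
  ultimately have "meval \<sigma> f * meval \<sigma> g' = (w * meval \<sigma> g) * meval \<sigma> g'"
    by (simp only: ac_simps)
  then show ?thesis using *(2) by simp
qed

lemma specialises_meval:
  assumes "in_ring X p" "\<And>v. v \<in> X \<Longrightarrow> specialises \<sigma> (f v) (f' v)"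
  shows "specialises \<sigma> (meval f p) (meval f' p)"
  unfolding meval_altdef
proof (rule rel_mpoly_eval[where R = "specialises \<sigma>"])
  show "specialises \<sigma> (to_frac (Poly_Mapping.single 0 a)) (to_frac (Poly_Mapping.single 0 a))" for a
    using specialises_to_frac[of \<sigma> "Poly_Mapping.single 0 a"] by (simp add: meval_const)
  show "specialises \<sigma> 0 0" "specialises \<sigma> 1 1"
    using specialises_to_frac[of \<sigma> 0] specialises_to_frac[of \<sigma> 1]
    by (simp_all add: Zero_fract_def One_fract_def)
qed (use assms in \<open>auto intro: specialises_add specialises_mult simp: in_ring_iff\<close>)

lemma to_frac_mono_eval: "to_frac (mono_eval N m) = mono_eval (\<lambda>v. to_frac (N v)) m"
  by (rule rel_mono_eval[where R = "\<lambda>x y. to_frac x = y"]) (auto simp: One_fract_def)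

lemma mono_eval_mult: "mono_eval (\<lambda>v. f v * g v) m = mono_eval f m * mono_eval g m"
  by (simp add: mono_eval_def power_mult_distrib prod.distrib)

lemma mono_eval_cong: "(\<And>v. v \<in> Poly_Mapping.keys m \<Longrightarrow> f v = g v) \<Longrightarrow> mono_eval f m = mono_eval g m"
  by (simp add: mono_eval_def cong: prod.cong)

lemma in_ring_mono_eval:
  "(\<And>v. v \<in> Poly_Mapping.keys m \<Longrightarrow> in_ring U (N v)) \<Longrightarrow> in_ring U (mono_eval N m)"
  unfolding mono_eval_def by (intro in_ring_prod in_ring_power)

lemma mono_eval_nonzero:
  "(\<And>v. v \<in> Poly_Mapping.keys m \<Longrightarrow> N v \<noteq> 0) \<Longrightarrow> mono_eval N m \<noteq> (0 :: 'a::idom mpoly)"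
  by (simp add: mono_eval_def)

lemma irreducible_dvd_mono_eval:
  fixes N :: "nat \<times> nat \<Rightarrow> 'a::{factorial_semiring, idom} mpoly"
  assumes "finite U" "\<And>v. v \<in> Poly_Mapping.keys m \<Longrightarrow> in_ring U (N v)"
    "in_ring U r" "irreducible r" "r dvd mono_eval N m"
  shows "\<exists>v\<in>Poly_Mapping.keys m. r dvd N v"
proof -
  obtain \<delta> where "factorial_subring (Collect (in_ring U :: 'a mpoly \<Rightarrow> bool)) \<delta>"
    using factorial_subring_in_ring[OF assms(1)] by blast
  then interpret factorial_subring "Collect (in_ring U :: 'a mpoly \<Rightarrow> bool)" \<delta> .
  have "\<exists>v\<in>Poly_Mapping.keys m. r dvd N v ^ Poly_Mapping.lookup m v"
    using assms by (intro irreducible_dvd_prod) (auto simp: mono_eval_def intro: in_ring_power)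
  then show ?thesis using irreducible_dvd_power[of _ r] assms by blast
qed

section \<open>Index shift of the iterates and its effect on denominators\<close>

locale recurrence_system =
  fixes d k :: nat and P Q :: "nat \<Rightarrow> 'a::idom mpoly" and tau :: "nat \<Rightarrow> nat \<Rightarrow> 'a mpoly fract"
  assumes P_ring: "i \<in> {1..d} \<Longrightarrow> in_ring ({1..d} \<times> {1..k}) (P i)"
    and Q_ring: "i \<in> {1..d} \<Longrightarrow> in_ring ({1..d} \<times> {1..k}) (Q i)"
    and tau_init: "j \<in> {1..d} \<Longrightarrow> l < k \<Longrightarrow> tau l j = to_frac (mvar (j, l))"
    and tau_wd: "k \<le> n \<Longrightarrow> i \<in> {1..d} \<Longrightarrow> meval (\<lambda>(j, l). tau (n - l) j) (Q i) \<noteq> 0"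
    and tau_rec: "k \<le> n \<Longrightarrow> i \<in> {1..d} \<Longrightarrow>
      tau n i = meval (\<lambda>(j, l). tau (n - l) j) (P i) / meval (\<lambda>(j, l). tau (n - l) j) (Q i)"
begin

text \<open>Below \<open>k\<close> the substitution replaces a variable by a shifted iterate; from
  \<open>k\<close> on, the same \<open>P i\<close> and \<open>Q i\<close> compute both sides, and
  \<open>tau_wd\<close> at \<open>n + s\<close> keeps the denominator nonzero after
  substitution.\<close>

lemma tau_shift:
  assumes "i \<in> {1..d}"
  shows "specialises (\<lambda>(j, l). tau (l + s) j) (tau n i) (tau (n + s) i)"
  using assms
proof (induction n arbitrary: i rule: less_induct)
  case (less n)
  let ?\<sigma> = "\<lambda>(j, l). tau (l + s) j"
  show ?case
  proof (cases "n < k")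
    case True
    then show ?thesis
      using specialises_to_frac[of ?\<sigma> "mvar (i, n)"] tau_init[of i n] less.prems
      by (simp add: meval_mvar)
  next
    case False
    \<comment> \<open>\<open>l \<ge> 1\<close> makes \<open>n - l\<close> smaller than
      \<open>n\<close>, and \<open>l \<le> k \<le> n\<close> keeps the subtraction exact.\<close>
    have *: "specialises ?\<sigma> ((\<lambda>(j, l). tau (n - l) j) v) ((\<lambda>(j, l). tau (n + s - l) j) v)"
      if "v \<in> {1..d} \<times> {1..k}" for v
      using that less.IH[of "n - snd v" "fst v"] False by (auto simp: add.commute)
    show ?thesis
      unfolding tau_rec[OF _ less.prems, of n, OF leI[OF False]]
        tau_rec[OF _ less.prems, of "n + s", OF trans_le_add1[OF leI[OF False]]]
      by (intro specialises_divide specialises_meval[OF P_ring] specialises_meval[OF Q_ring]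
          tau_wd less.prems *) (use False in auto)
  qed
qed

text \<open>If \<open>tau n i\<close> is \<open>f\<close> over a monomial in \<open>V\<close>, then
  after the shift \<open>tau (n + s) i\<close> times that monomial, taken at shifted iterates,
  equals \<open>f\<close> at shifted iterates. Laurent cofactors then turn each iterate in the
  monomial into its \<open>N\<close>.\<close>

lemma clear_denominators:
  fixes s :: nat and N :: "nat \<times> nat \<Rightarrow> 'a mpoly"
  defines "U \<equiv> {(j, l). j \<in> {1..d} \<and> l < k}"
  assumes "V \<subseteq> U" "i \<in> {1..d}" and tau: "tau n i \<in> laurent U V"
    and shifted: "\<And>j l. (j, l) \<in> U \<Longrightarrow> tau (l + s) j \<in> laurent U V"
    and nonzero: "\<And>j l. (j, l) \<in> V \<Longrightarrow> tau (l + s) j \<noteq> 0"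
    and numer: "\<And>j l. (j, l) \<in> V \<Longrightarrow> to_frac (N (j, l)) / tau (l + s) j \<in> laurent U V"
  shows "\<exists>m. Poly_Mapping.keys m \<subseteq> V \<and> tau (n + s) i * to_frac (mono_eval N m) \<in> laurent U V"
proof -
  let ?\<sigma> = "\<lambda>(j, l). tau (l + s) j"
  obtain f m where fm: "in_ring U f" "Poly_Mapping.keys m \<subseteq> V" "tau n i = Fract f (Poly_Mapping.single m 1)"
    using tau by (auto elim: laurentE)
  have "tau (n + s) i * mono_eval ?\<sigma> m = meval ?\<sigma> f"
    using specialises_Fract[OF tau_shift[OF assms(3), of s n, unfolded fm(3)]]
    by (simp add: single_0_eq_iff meval_monom)
  moreover have "to_frac (mono_eval N m) = mono_eval (\<lambda>v. ?\<sigma> v * (to_frac (N v) / ?\<sigma> v)) m"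
    unfolding to_frac_mono_eval using fm(2) nonzero by (intro mono_eval_cong) auto
  ultimately have "tau (n + s) i * to_frac (mono_eval N m)
      = meval ?\<sigma> f * mono_eval (\<lambda>v. to_frac (N v) / ?\<sigma> v) m"
    by (simp only: mono_eval_mult mult.assoc[symmetric])
  moreover have "meval ?\<sigma> f \<in> laurent U V"
    by (rule meval_in_laurent[OF assms(2) fm(1)]) (use shifted in auto)
  moreover have "mono_eval (\<lambda>v. to_frac (N v) / ?\<sigma> v) m \<in> laurent U V"
    by (rule mono_eval_in_laurent) (use fm(2) numer in auto)
  ultimately have "tau (n + s) i * to_frac (mono_eval N m) \<in> laurent U V"
    by (simp only: mult_in_laurent)
  with fm(2) show ?thesis by blast
qed

end

section \<open>Divisibility within \<open>R[U]\<close> and the Laurent property\<close>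

lemma in_ring_monomial: "is_monomial_in X p \<Longrightarrow> in_ring X p"
  by (auto simp: is_monomial_in_def in_ring_single)

lemma dvd_in_imp_dvd: "dvd_in X a b \<Longrightarrow> a dvd b"
  by (auto simp: dvd_in_def)

lemma dvd_imp_dvd_in:
  fixes a b :: "'a::idom mpoly"
  assumes "a dvd b" "in_ring X b" "b \<noteq> 0"
  shows "dvd_in X a b"
proof -
  obtain e where e: "b = a * e" using assms(1) by (auto elim: dvdE)
  moreover have "in_ring X e" using in_ring_dvd[OF _ assms(2,3), of e] e by simp
  ultimately show ?thesis by (auto simp: dvd_in_def)
qed

text \<open>Everything divides 0, so \<open>a\<close> is itself a common factor. This handles
  vanishing numerators.\<close>

lemma coprime_in_0_left: "coprime_in X 0 a \<Longrightarrow> in_ring X a \<Longrightarrow> a dvd 1"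
  unfolding coprime_in_def dvd_in_def
  by (metis dvd_triv_left in_ring_0 in_ring_1 mult_1_right mult_zero_right)

lemma coprime_in_commute: "coprime_in X a b \<longleftrightarrow> coprime_in X b a"
  by (auto simp: coprime_in_def)

lemma finite_indices: "finite {(j, l). j \<in> {1..d::nat} \<and> l < (k::nat)}"
  by (rule finite_subset[of _ "{1..d} \<times> {..<k}"]) auto

theorem theorem2:
  fixes d k :: nat
    and P Q :: "nat \<Rightarrow> 'a::{factorial_semiring, idom} mpoly"
    and tau :: "nat \<Rightarrow> nat \<Rightarrow> 'a mpoly fract"
    and p q :: "nat \<Rightarrow> nat \<Rightarrow> 'a mpoly"
    and I :: "nat set"
  defines "U \<equiv> {(j, l). j \<in> {1..d} \<and> l < k}"
      and "V \<equiv> {(j, l). j \<in> I \<and> l < k}"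
  assumes "d \<ge> 1" and "k \<ge> 1"
    and P_poly: "\<forall>i\<in>{1..d}. in_ring ({1..d} \<times> {1..k}) (P i)"
    and Q_mono: "\<forall>i\<in>{1..d}. is_monomial_in ({1..d} \<times> {1..k}) (Q i)"
    and tau_init: "\<forall>j\<in>{1..d}. \<forall>l<k. tau l j = to_frac (mvar (j, l))"
    and tau_wd: "\<forall>n\<ge>k. \<forall>i\<in>{1..d}. meval (\<lambda>(j, l). tau (n - l) j) (Q i) \<noteq> 0"
    and tau_rec: "\<forall>n\<ge>k. \<forall>i\<in>{1..d}.
        tau n i = meval (\<lambda>(j, l). tau (n - l) j) (P i) / meval (\<lambda>(j, l). tau (n - l) j) (Q i)"
    and pq: "\<forall>n. \<forall>i\<in>{1..d}. in_ring U (p n i) \<and> in_ring U (q n i) \<and> q n i \<noteq> 0 \<and>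
        coprime_in U (p n i) (q n i) \<and> tau n i = Fract (p n i) (q n i)"
    and I_sub: "I \<subseteq> {1..d}"
    and h1: "\<forall>i\<in>{1..d}. is_monomial_in V (q k i)"
    and h2: "\<forall>i\<in>I. \<forall>j\<in>I. \<forall>l\<in>{1..k}. coprime_in U (p k i) (p (k + l) j)"
    and h3: "\<forall>i\<in>{1..d}. \<forall>m\<in>{k+1..2*k}. is_monomial_in V (q m i)"
  shows "\<forall>n. \<forall>i\<in>{1..d}. \<exists>f m. in_ring U f \<and> Poly_Mapping.keys m \<subseteq> V \<and>
            tau n i = Fract f (Poly_Mapping.single m 1)"
proof -
  interpret recurrence_system d k P Q tau
    by unfold_locales (use P_poly Q_mono tau_init tau_wd tau_rec in_ring_monomial in blast)+
  have finU: "finite U" unfolding U_def by (rule finite_indices)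
  have VU: "V \<subseteq> U" using I_sub by (auto simp: U_def V_def)
  \<comment> \<open>The range up to \<open>2 * k\<close> comes directly from the initial values and
    the hypotheses on \<open>q\<close>.\<close>
  have init: "tau n i \<in> laurent U V" if "n \<le> 2 * k" "i \<in> {1..d}" for n i
  proof (cases "n < k")
    case True
    then show ?thesis
      using that tau_init by (auto simp: U_def intro!: to_frac_in_laurent in_ring_mvar)
  next
    case False
    then have "is_monomial_in V (q n i)" using h1 h3 that by (cases "n = k") auto
    then have "Fract (p n i) (q n i) \<in> laurent U V" using Fract_monomial_in_laurent pq that by blast
    then show ?thesis using pq that by metis
  qed
  \<comment> \<open>A shifted index below \<open>k\<close> still denotes a variable of
    \<open>V\<close>, already invertible, so 1 suffices. Otherwise the numerator divided by the
    iterate is the polynomial \<open>q (l + s) j\<close>.\<close>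
  define N where "N = (\<lambda>s (j, l). if l + s < k then 1 else p (l + s) j)"
  have N_ring: "in_ring U (N s v)" if "v \<in> V" for s v
    using that pq I_sub by (auto simp: N_def V_def)
  \<comment> \<open>The bounds \<open>s \<le> k + 1\<close> and \<open>l < k\<close> keep
    \<open>l + s\<close> within \<open>2 * k\<close>, where \<open>init\<close> applies.\<close>
  have shift: "\<exists>m. Poly_Mapping.keys m \<subseteq> V \<and> mono_eval (N s) m \<noteq> 0 \<and>
      tau (n + s) i * to_frac (mono_eval (N s) m) \<in> laurent U V"
    if s: "s \<le> k + 1" "i \<in> {1..d}" "tau n i \<in> laurent U V"
      and nz: "\<And>j l. j \<in> I \<Longrightarrow> l < k \<Longrightarrow> k \<le> l + s \<Longrightarrow> p (l + s) j \<noteq> 0" for s n i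
  proof -
    have nonzero: "tau (l + s) j \<noteq> 0 \<and> to_frac (N s (j, l)) / tau (l + s) j \<in> laurent U V"
      if "(j, l) \<in> V" for j l
    proof (cases "l + s < k")
      case True
      then have "tau (l + s) j = to_frac (mvar (j, l + s))" "(j, l + s) \<in> V"
        using that tau_init I_sub by (auto simp: V_def)
      then show ?thesis using True laurentI[of U 1 "Poly_Mapping.single (j, l + s) 1" V]
        by (simp add: N_def mvar_def Zero_fract_def eq_fract single_0_eq_iff)
    next
      case False
      then have j: "j \<in> {1..d}" and pnz: "p (l + s) j \<noteq> 0" using that I_sub nz by (auto simp: V_def)
      then have t: "tau (l + s) j = Fract (p (l + s) j) (q (l + s) j)" "q (l + s) j \<noteq> 0"
        "in_ring U (q (l + s) j)" using pq by blast+
      have "to_frac (N s (j, l)) / tau (l + s) j = to_frac (q (l + s) j)"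
        using False pnz t by (simp add: N_def eq_fract)
      moreover have "tau (l + s) j \<noteq> 0" using pnz t by (simp add: Zero_fract_def eq_fract)
      ultimately show ?thesis using to_frac_in_laurent[OF t(3), of V] by (simp only: simp_thms)
    qed
    have "\<exists>m. Poly_Mapping.keys m \<subseteq> V \<and> tau (n + s) i * to_frac (mono_eval (N s) m) \<in> laurent U V"
    proof (rule clear_denominators[folded U_def])
      show "tau (l + s) j \<in> laurent U V" if "(j, l) \<in> U" for j l
        using that s(1) by (intro init) (auto simp: U_def)
    qed (use VU s nonzero in auto)
    then obtain m where m: "Poly_Mapping.keys m \<subseteq> V"
      "tau (n + s) i * to_frac (mono_eval (N s) m) \<in> laurent U V" by blast
    moreover have "mono_eval (N s) m \<noteq> 0"
    proof (rule mono_eval_nonzero)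
      fix v assume "v \<in> Poly_Mapping.keys m"
      then obtain j l where "v = (j, l)" "j \<in> I" "l < k" using m(1) by (auto simp: V_def)
      then show "N s v \<noteq> 0" using nz[of j l] by (simp add: N_def)
    qed
    ultimately show ?thesis by blast
  qed
  have dvd_N: "\<exists>j\<in>I. \<exists>l<k. k \<le> l + s \<and> r dvd p (l + s) j"
    if r: "in_ring U r" "irreducible r" "r dvd mono_eval (N s) m" and m: "Poly_Mapping.keys m \<subseteq> V" for r s m
  proof -
    obtain v where v: "v \<in> V" "r dvd N s v"
      using irreducible_dvd_mono_eval[OF finU _ r] N_ring m by blast
    moreover have "\<not> r dvd 1" using r(2) by (auto simp: irreducible_def)
    ultimately show ?thesis by (force simp: N_def V_def split: if_splits)
  qed
  have I_ring: "in_ring U (p n j)" if "j \<in> I" for n j using that pq I_sub by blast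
  have main: "tau n i \<in> laurent U V" if "i \<in> {1..d}" for n i
    using that
  proof (induction n arbitrary: i rule: less_induct)
    case (less n)
    \<comment> \<open>A nonzero \<open>A\<close> without irreducible factors is a unit, so
      multiplying by its inverse recovers \<open>z\<close>.\<close>
    have only: "z \<in> laurent U V"
      if z: "z * to_frac A \<in> laurent U V" "in_ring U A" "A \<noteq> 0"
        and no: "\<And>r. in_ring U r \<Longrightarrow> irreducible r \<Longrightarrow> \<not> r dvd A" for z and A :: "'a mpoly"
    proof -
      obtain \<delta> where "factorial_subring (Collect (in_ring U :: 'a mpoly \<Rightarrow> bool)) \<delta>"
        using factorial_subring_in_ring[OF finU] by blast
      then have "A dvd 1" using factorial_subring.irreducible_factor_exists z no by blast
      then obtain e where e: "1 = A * e" by (auto elim: dvdE)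
      have "e dvd 1" unfolding e by simp
      then have "in_ring U e" using in_ring_dvd[of e 1 U] by simp
      then have "z * to_frac A * to_frac e \<in> laurent U V"
        by (intro mult_in_laurent[OF z(1)] to_frac_in_laurent)
      moreover have "to_frac A * to_frac e = 1" using e by (simp add: One_fract_def)
      ultimately show ?thesis by (simp only: mult.assoc mult_1_right)
    qed
    show ?case
    proof (cases "n \<le> 2 * k")
      case False
      \<comment> \<open>As \<open>n > 2 * k\<close>, both \<open>a\<close> and \<open>b\<close> are
        genuine smaller indices, from which \<open>n\<close> is reached by the shifts 1 and
        \<open>k + 1\<close>.\<close>
      define a where "a = n - 1"
      define b where "b = n - (k + 1)"
      have ab: "n = a + 1" "n = b + (k + 1)" using False by (auto simp: a_def b_def)
      have L: "tau a i \<in> laurent U V" "tau b i \<in> laurent U V"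
        using less.IH[OF _ less.prems] ab by auto
      \<comment> \<open>Shift 1 contributes numerators only for \<open>l = k - 1\<close>, that is at
        index \<open>k\<close>; shift \<open>k + 1\<close> contributes those at
        \<open>k + (l' + 1)\<close> with \<open>l' + 1\<close> in \<open>{1..k}\<close>, exactly the
        pairs in \<open>h2\<close>.\<close>
      have cop: "coprime_in U (p (l + 1) i') (p (l' + (k + 1)) j)"
        if "i' \<in> I" "j \<in> I" "l < k" "l' < k" "k \<le> l + 1" for i' j l l'
      proof -
        have l: "l + 1 = k" and l': "l' + (k + 1) = k + (l' + 1)" using that by simp_all
        have "l' + 1 \<in> {1..k}" using that by simp
        then show ?thesis unfolding l l' using h2 that(1,2) by blast
      qed
      \<comment> \<open>\<open>shift\<close> requires nonzero numerators. If one vanishes for one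
        shift, all those of the other shift are units and that shift alone suffices; otherwise both
        are combined.\<close>
      consider (a) i' l where "i' \<in> I" "l < k" "k \<le> l + 1" "p (l + 1) i' = 0"
        | (b) j l where "j \<in> I" "l < k" "p (l + (k + 1)) j = 0"
        | (c) "\<And>j l. j \<in> I \<Longrightarrow> l < k \<Longrightarrow> k \<le> l + 1 \<Longrightarrow> p (l + 1) j \<noteq> 0"
              "\<And>j l. j \<in> I \<Longrightarrow> l < k \<Longrightarrow> p (l + (k + 1)) j \<noteq> 0"
        by blast
      then show ?thesis
      proof cases
        case a
        have unit: "p (l' + (k + 1)) j dvd 1" if "j \<in> I" "l' < k" for j l'
          using coprime_in_0_left cop[OF a(1) that(1) a(2) that(2) a(3)] a(4) I_ring that(1) by metis
        obtain m where m: "Poly_Mapping.keys m \<subseteq> V" "mono_eval (N (k + 1)) m \<noteq> 0"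
          "tau n i * to_frac (mono_eval (N (k + 1)) m) \<in> laurent U V"
          unfolding ab(2) using shift[OF _ less.prems L(2), of "k + 1"] unit by fastforce
        show ?thesis
        proof (rule only[OF m(3) _ m(2)])
          show "in_ring U (mono_eval (N (k + 1)) m)" using N_ring m by (intro in_ring_mono_eval) blast
          show "\<not> r dvd mono_eval (N (k + 1)) m" if "in_ring U r" "irreducible r" for r
            using dvd_N[OF that _ m(1)] unit that(2) by (meson dvd_trans irreducible_def)
        qed
      next
        case b
        have unit: "p (l' + 1) j dvd 1" if "j \<in> I" "l' < k" "k \<le> l' + 1" for j l'
          using coprime_in_0_left cop[OF that(1) b(1) that(2) b(2) that(3)] b(3) I_ring that(1)
            coprime_in_commute by metis
        obtain m where m: "Poly_Mapping.keys m \<subseteq> V" "mono_eval (N 1) m \<noteq> 0"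
          "tau n i * to_frac (mono_eval (N 1) m) \<in> laurent U V"
          unfolding ab(1) using shift[OF _ less.prems L(1), of 1] unit by fastforce
        show ?thesis
        proof (rule only[OF m(3) _ m(2)])
          show "in_ring U (mono_eval (N 1) m)" using N_ring m by (intro in_ring_mono_eval) blast
          show "\<not> r dvd mono_eval (N 1) m" if "in_ring U r" "irreducible r" for r
            using dvd_N[OF that _ m(1)] unit that(2) by (meson dvd_trans irreducible_def)
        qed
      next
        case c
        obtain m where m: "Poly_Mapping.keys m \<subseteq> V" "mono_eval (N 1) m \<noteq> 0"
          "tau n i * to_frac (mono_eval (N 1) m) \<in> laurent U V"
          unfolding ab(1) using shift[OF _ less.prems L(1), of 1] c(1) by auto
        obtain m' where m': "Poly_Mapping.keys m' \<subseteq> V" "mono_eval (N (k + 1)) m' \<noteq> 0"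
          "tau n i * to_frac (mono_eval (N (k + 1)) m') \<in> laurent U V"
          unfolding ab(2) using shift[OF _ less.prems L(2), of "k + 1"] c(2) by auto
        show ?thesis
        proof (rule laurent_coprime_multiples[OF finU VU _ _ m(2) m'(2) _ m(3) m'(3)])
          show "in_ring U (mono_eval (N 1) m)" "in_ring U (mono_eval (N (k + 1)) m')"
            using N_ring m(1) m'(1) by (intro in_ring_mono_eval; blast)+
          \<comment> \<open>A common irreducible factor would divide one numerator from each shift,
            and \<open>cop\<close> would make it a unit.\<close>
          fix r assume r: "in_ring U r" "irreducible r" "r dvd mono_eval (N 1) m"
          show "\<not> r dvd mono_eval (N (k + 1)) m'"
          proof
            assume "r dvd mono_eval (N (k + 1)) m'"
            then obtain j l' where j: "j \<in> I" "l' < k" "r dvd p (l' + (k + 1)) j"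
              using dvd_N[OF r(1,2) _ m'(1)] by blast
            obtain i' l where i': "i' \<in> I" "l < k" "k \<le> l + 1" "r dvd p (l + 1) i'"
              using dvd_N[OF r m(1)] by blast
            have "dvd_in U r (p (l + 1) i')" "dvd_in U r (p (l' + (k + 1)) j)"
              using dvd_imp_dvd_in[OF i'(4) I_ring[OF i'(1)] c(1)[OF i'(1-3)]]
                dvd_imp_dvd_in[OF j(3) I_ring[OF j(1)] c(2)[OF j(1,2)]] .
            then have "dvd_in U r 1"
              using cop[OF i'(1) j(1) i'(2) j(2) i'(3)] r(1) unfolding coprime_in_def by blast
            then have "r dvd 1" by (rule dvd_in_imp_dvd)
            then show False using r(2) by (auto simp: irreducible_def)
          qed
        qed
      qed
    qed (use init less.prems in auto)
  qed
  then show ?thesis by (metis laurentE)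
qed

end
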